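(* Let $\mathcal{V}$ be the simplex of all Borel probability measures on the cone of distance matrices $\mathcal{R}$, equipped with the weak topology. The subset of measures in $\mathcal{V}$ that are concentrated on the set of universal matrices is an everywhere dense $G_\delta$-set in $\mathcal{V}$. Thus, for a generic measure $\nu\in\mathcal{V}$ (that is, for all $\nu$ in some everywhere dense $G_\delta$-subset of $\mathcal{V}$), $\nu$-almost every distance matrix is universal and hence determines a metric $r$ on the set of positive integers $\mathbf{N}$ such that the completion of $\mathbf{N}$ with respect to this metric is the Urysohn space.
   Context: $\mathcal{R}$ is the set of all real matrices $r=\{r_{i,j}\}_{i,j=1}^\infty$ with $r_{i,i}=0$, $r_{i,j}\ge 0$, $r_{i,j}=r_{j,i}$ and $r_{i,k}+r_{k,j}\ge r_{i,j}$ for all $i,j,k$, with the topology of entrywise convergence (a Polish topology). The weak topology on $\mathcal{V}$ is the usual topology of weak convergence of probability measures on $\mathcal{R}$ (equivalently, convergence of finite-dimensional distributions, i.e. $\mathcal{V}$ is the inverse limit of the spaces of probability measures on the finite-dimensional cones of distance matrices of order $n$). For $r\in\mathcal{R}$, $p_n(r)=\{r_{i,j}\}_{i,j=1}^n$; for a distance matrix $q$ of order $n$, $A(q)=\{(a_1,\dots,a_n)\in\mathbf{R}^n: |a_i-a_j|\le q_{i,j}\le a_i+a_j,\ i,j=1,\dots,n\}$. A matrix $r\in\mathcal{R}$ is called universal if for every $\epsilon>0$, every $n\in\mathbf{N}$ and every $a\in A(p_n(r))$ there exists $m\in\mathbf{N}$ with $\max_{i\le n}|r_{i,m}-a_i|<\epsilon$.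 A measure is concentrated on a set if the complement of the set has measure zero. The Urysohn space is the complete separable metric space, unique up to isometry, that contains an isometric copy of every complete separable metric space and in which every isometry between two finite subsets extends to an isometry of the whole space onto itself. *)

theory Defs
  imports "HOL-Probability.Probability"
begin

subsection \<open>Distance matrices and universality\<close>

text \<open>Matrices are indexed from 0, so the principal corner of order \<open>n\<close> has index set
  \<open>{..<n}\<close>. Off-diagonal zeros are allowed, i.e. the elements are semimetrics on the index set.
  The type \<open>nat \<Rightarrow> nat \<Rightarrow> real\<close> carries the topology of entrywise convergence.\<close>

definition distance_matrices :: "(nat \<Rightarrow> nat \<Rightarrow> real) set" where
  "distance_matrices =
     {r. \<forall>i j k. r i i = 0 \<and> r i j \<ge> 0 \<and> r i j = r j i \<and> r i k + r k j \<ge> r i j}"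

text \<open>Only the entries with indices below \<open>n\<close> matter in the following set, so that
  \<open>admissible n r\<close> depends on \<open>r\<close> only through its corner of order \<open>n\<close>; the values of \<open>a\<close>
  beyond \<open>n\<close> are irrelevant.\<close>

definition admissible :: "nat \<Rightarrow> (nat \<Rightarrow> nat \<Rightarrow> real) \<Rightarrow> (nat \<Rightarrow> real) set" where
  "admissible n q =
     {a. \<forall>i<n. \<forall>j<n. \<bar>a i - a j\<bar> \<le> q i j \<and> q i j \<le> a i + a j}"

definition universal_matrices :: "(nat \<Rightarrow> nat \<Rightarrow> real) set" where
  "universal_matrices =
     {r \<in> distance_matrices.
        \<forall>\<epsilon>>0. \<forall>n. \<forall>a \<in> admissible n r. \<exists>m. \<forall>i<n. \<bar>r i m - a i\<bar> < \<epsilon>}"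

subsection \<open>The space of measures\<close>

definition matrix_measures :: "(nat \<Rightarrow> nat \<Rightarrow> real) measure set" where
  "matrix_measures =
     {\<nu>. prob_space \<nu> \<and> sets \<nu> = sets (restrict_space borel distance_matrices)}"

text \<open>Weak convergence: the coarsest topology making integration of every bounded continuous
  real function on the distance matrices continuous.\<close>

definition weak_topology :: "(nat \<Rightarrow> nat \<Rightarrow> real) measure topology" where
  "weak_topology = topology_generated_by
     {{\<nu> \<in> matrix_measures. (\<integral>r. f r \<partial>\<nu>) \<in> W} | f W.
        continuous_on distance_matrices f \<and> bounded (f ` distance_matrices) \<and> open (W :: real set)}"

lemma topspace_weak_topology [simp]: "topspace weak_topology = matrix_measures"
proof -
  have "matrix_measures \<in> {{\<nu> \<in> matrix_measures. (\<integral>r. f r \<partial>\<nu>) \<in> W} | f W.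
        continuous_on distance_matrices f \<and> bounded (f ` distance_matrices) \<and> open (W :: real set)}"
    by (rule CollectI, rule exI[of _ "\<lambda>_. 0"], rule exI[of _ UNIV])
       (auto intro: finite_imp_bounded finite_subset[of _ "{0}"])
  then show ?thesis
    unfolding weak_topology_def topology_generated_by_topspace by blast
qed

definition universally_concentrated :: "(nat \<Rightarrow> nat \<Rightarrow> real) measure set" where
  "universally_concentrated =
     {\<nu> \<in> matrix_measures. distance_matrices - universal_matrices \<in> null_sets \<nu>}"

subsection \<open>The Urysohn space\<close>

definition isometric_embedding :: "'a metric \<Rightarrow> 'b metric \<Rightarrow> ('a \<Rightarrow> 'b) \<Rightarrow> bool" where
  "isometric_embedding m m' f \<longleftrightarrow>
     f \<in> mspace m \<rightarrow> mspace m' \<and>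
     (\<forall>x\<in>mspace m. \<forall>y\<in>mspace m. mdist m' (f x) (f y) = mdist m x y)"

text \<open>Universality is stated for spaces whose points are real numbers. This is no restriction,
  as a separable metric space has at most continuum many points; see
  \<open>urysohn_space_universal\<close> below.\<close>

definition urysohn_space :: "'a metric \<Rightarrow> bool" where
  "urysohn_space U \<longleftrightarrow>
     mcomplete_of U \<and> separable_space (mtopology_of U) \<and>
     (\<forall>X :: real metric. mcomplete_of X \<and> separable_space (mtopology_of X) \<longrightarrow>
        (\<exists>f. isometric_embedding X U f)) \<and>
     (\<forall>F g. finite F \<and> F \<subseteq> mspace U \<and> isometric_embedding (submetric U F) U g \<longrightarrow>
        (\<exists>h. isometric_embedding U U h \<and> h ` mspace U = mspace U \<and> (\<forall>x\<in>F. h x = g x)))"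

lemma separable_metric_inj_real:
  fixes m :: "'a metric"
  assumes "separable_space (mtopology_of m)"
  obtains e :: "'a \<Rightarrow> real" where "inj_on e (mspace m)"
proof -
  interpret M: Metric_space "mspace m" "mdist m" by simp
  obtain C where C: "countable C" "C \<subseteq> mspace m" "mtopology_of m closure_of C = mspace m"
    using assms unfolding separable_space_def by auto
  define D where "D = (\<lambda>x. {(c, q :: rat). c \<in> C \<and> mdist m x c < of_rat q})"
  have "inj_on D (mspace m)"
  proof (rule inj_onI, rule ccontr)
    fix x y assume xy: "x \<in> mspace m" "y \<in> mspace m" "D x = D y" "x \<noteq> y"
    then have pos: "mdist m x y > 0" by simp
    have "x \<in> M.mtopology closure_of C"
      using C(3) xy(1) by (simp add: mtopology_of_def)
    then obtain c where c: "c \<in> C" "c \<in> M.mball x (mdist m x y / 2)"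
      using pos unfolding M.metric_closure_of by (auto dest: spec[of _ "mdist m x y / 2"])
    then have lt: "mdist m x c < mdist m x y / 2" by simp
    then obtain q where q: "mdist m x c < of_rat q" "of_rat q < mdist m x y / 2"
      using of_rat_dense by blast
    then have "(c, q) \<in> D y" using c(1) xy(3) by (auto simp: D_def)
    then have "mdist m y c < mdist m x y / 2" using q(2) by (auto simp: D_def)
    moreover have "mdist m x y \<le> mdist m x c + mdist m y c"
      using M.triangle[of x c y] xy C(2) c(1) by (metis M.commute subsetD)
    ultimately show False using lt by simp
  qed
  moreover have cnt: "countable (C \<times> (UNIV :: rat set))" using C(1) by simp
  have "inj_on (\<lambda>A. to_nat_on (C \<times> (UNIV :: rat set)) ` A) (D ` mspace m)"
    by (rule inj_on_subset[OF inj_on_image_Pow[OF inj_on_to_nat_on[OF cnt]]]) (auto simp: D_def)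
  moreover obtain g :: "nat set \<Rightarrow> real" where "inj g"
    using nat_sets_lepoll_reals01 unfolding lepoll_def by blast
  ultimately have "inj_on (g \<circ> ((\<lambda>A. to_nat_on (C \<times> (UNIV :: rat set)) ` A) \<circ> D)) (mspace m)"
    by (meson comp_inj_on inj_on_subset subset_UNIV)
  then show thesis by (rule that)
qed

lemma urysohn_space_universal:
  fixes X :: "'b metric"
  assumes U: "urysohn_space U" and X: "mcomplete_of X" "separable_space (mtopology_of X)"
  shows "\<exists>f. isometric_embedding X U f"
proof -
  interpret X: Metric_space "mspace X" "mdist X" by simp
  obtain e :: "'b \<Rightarrow> real" where e: "inj_on e (mspace X)"
    using separable_metric_inj_real[OF X(2)] .
  define i where "i = inv_into (mspace X) e"
  define d where "d = (\<lambda>x y. mdist X (i x) (i y))"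
  have ie: "i (e x) = x" if "x \<in> mspace X" for x
    using e that by (simp add: i_def)
  have iY: "i y \<in> mspace X" "e (i y) = y" if "y \<in> e ` mspace X" for y
    using that by (auto simp: i_def inv_into_into f_inv_into_f)
  interpret Y: Metric_space "e ` mspace X" d
  proof
    fix x y z assume "x \<in> e ` mspace X" "y \<in> e ` mspace X"
    then show "d x y = 0 \<longleftrightarrow> x = y"
      unfolding d_def using X.zero iY by metis
  next
    fix x y z assume "x \<in> e ` mspace X" "y \<in> e ` mspace X" "z \<in> e ` mspace X"
    then show "d x z \<le> d x y + d y z"
      unfolding d_def using X.triangle iY by metis
  qed (auto simp: d_def X.commute)
  interpret XY: Metric_space12 "mspace X" "mdist X" "e ` mspace X" d ..
  have "homeomorphic_map X.mtopology Y.mtopology e"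
    by (rule XY.isometry_imp_homeomorphic_map) (auto simp: d_def ie)
  then have hom: "X.mtopology homeomorphic_space Y.mtopology"
    by (rule homeomorphic_map_imp_homeomorphic_space)
  have sep: "separable_space Y.mtopology"
    using X(2) homeomorphic_separable_space[OF hom] by (simp add: mtopology_of_def)
  have "Y.mcomplete"
    unfolding Y.mcomplete_def
  proof (intro allI impI)
    fix s assume s: "Y.MCauchy s"
    then have sY: "s n \<in> e ` mspace X" for n
      unfolding Y.MCauchy_def by blast
    have "X.MCauchy (i \<circ> s)"
      using s[unfolded Y.MCauchy_def] iY(1)[OF sY] by (auto simp: X.MCauchy_def d_def)
    then obtain x where "limitin X.mtopology (i \<circ> s) x sequentially"
      using X(1) X.mcomplete_def unfolding mcomplete_of_def by blast
    then have "limitin Y.mtopology s (e x) sequentially"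
      unfolding X.limitin_metric Y.limitin_metric using sY
      by (auto simp: ie d_def elim: eventually_mono)
    then show "\<exists>y. limitin Y.mtopology s y sequentially" ..
  qed
  then obtain f where f: "isometric_embedding Y.Self U f"
    using U sep unfolding urysohn_space_def by (metis Y.Self_def Y.mcomplete_of Y.mtopology_of)
  have "isometric_embedding X U (f \<circ> e)"
    using f unfolding isometric_embedding_def Y.mspace_Self Y.mdist_Self
    by (auto simp: d_def ie)
  then show ?thesis by blast
qed

subsection \<open>Completions\<close>

text \<open>For a metric \<open>r\<close> this is the usual notion of completion; for a semimetric, \<open>f\<close> identifies
  the points at distance 0. A completion is determined up to isometry, and by separability it can
  always be realised on a set of reals.\<close>

definition is_completion :: "(nat \<Rightarrow> nat \<Rightarrow> real) \<Rightarrow> 'a metric \<Rightarrow> (nat \<Rightarrow> 'a) \<Rightarrow> bool" where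
  "is_completion r U f \<longleftrightarrow>
     mcomplete_of U \<and> range f \<subseteq> mspace U \<and> (\<forall>i j. mdist U (f i) (f j) = r i j) \<and>
     mtopology_of U closure_of range f = mspace U"

definition completion_is_urysohn :: "(nat \<Rightarrow> nat \<Rightarrow> real) \<Rightarrow> bool" where
  "completion_is_urysohn r \<longleftrightarrow>
     (\<exists>(U :: real metric) f. is_completion r U f \<and> urysohn_space U)"

end

theory Submission
  imports Defs
begin

text \<open>A matrix is universal iff it satisfies countably many open conditions, each a rational
  instance of approximate extensibility. Each condition is dense, since a single new point realises
  it, so Baire's theorem yields universal matrices (with nonzero off-diagonal entries, if desired)
  arbitrarily close to any given one. Concentration on an open set \<open>S\<close> is \<open>G\<^sub>\<delta>\<close> because
  \<open>\<nu> \<mapsto> \<nu>(S)\<close> is lower semicontinuous, and density in the space of matrices lifts to density in the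
  space of measures by pushing a measure forward along small displacements.
  In the completion of a universal matrix, approximate extensions improve to exact one-point
  extensions of finite subsets; back-and-forth then gives universality and homogeneity.\<close>

subsection \<open>Katetov functions\<close>

text \<open>A universal matrix may have zeros off the diagonal: repeating a row and column keeps it
  universal. Concentration on the universal matrices therefore does not yet give a metric on the
  indices, and the generic set in the last claim about measures comes from a larger family, with the
  open dense conditions \<open>r i j \<noteq> 0\<close> added. A completion identifies points at
  distance 0, so the Urysohn claim holds for every universal matrix. The common language is that of
  Katetov functions, the distance vectors of a prospective new point. Admissible vectors are the
  Katetov functions on an initial segment of indices. Extending an approximate one from a finite set
  to the whole space, with error \<open>\<delta> / 2\<close>, serves three ends: it repairs relaxed
  rational data, it supplies the new point in the density argument, and with
  \<open>\<delta> = 0\<close> it carries a problem on a finite subset of the completion over to the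
  dense sequence, where universality applies.\<close>

definition katetov_on :: "'a set \<Rightarrow> ('a \<Rightarrow> 'a \<Rightarrow> real) \<Rightarrow> ('a \<Rightarrow> real) \<Rightarrow> bool" where
  "katetov_on S d a \<longleftrightarrow> (\<forall>x\<in>S. \<forall>y\<in>S. \<bar>a x - a y\<bar> \<le> d x y \<and> d x y \<le> a x + a y)"

lemma admissible_iff_katetov_on: "a \<in> admissible n r \<longleftrightarrow> katetov_on {..<n} r a"
  by (auto simp: admissible_def katetov_on_def)

text \<open>\<open>\<eta>\<close> is the intended distance from \<open>z\<close> to the point that
  \<open>a\<close> describes; the two bounds are the triangle inequalities among \<open>x\<close>,
  \<open>z\<close> and that point.\<close>

lemma katetov_on_insert:
  assumes a: "katetov_on F d a" and z: "z \<notin> F" "d z z = 0" "\<And>x. d z x = d x z" and "0 \<le> \<eta>"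
    and \<eta>: "\<And>x. x \<in> F \<Longrightarrow> \<bar>d x z - a x\<bar> \<le> \<eta>" "\<And>x. x \<in> F \<Longrightarrow> \<eta> \<le> a x + d x z"
  shows "katetov_on (insert z F) d (a(z := \<eta>))"
  unfolding katetov_on_def
proof (intro ballI)
  fix x y assume xy: "x \<in> insert z F" "y \<in> insert z F"
  consider "x \<in> F" "y \<in> F" "x \<noteq> z" "y \<noteq> z" | "x \<in> F" "x \<noteq> z" "y = z" | "x = z" "y \<in> F" "y \<noteq> z" | "x = z" "y = z"
    using xy z(1) by auto
  then show "\<bar>(a(z := \<eta>)) x - (a(z := \<eta>)) y\<bar> \<le> d x y \<and> d x y \<le> (a(z := \<eta>)) x + (a(z := \<eta>)) y"
  proof cases
    case 1
    then show ?thesis using a by (simp add: katetov_on_def)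
  next
    case 2
    then show ?thesis using \<eta>[of x] by (simp add: abs_le_iff)
  next
    case 3
    then show ?thesis using \<eta>[of y] z(3)[of y] by (simp add: abs_le_iff)
  next
    case 4
    then show ?thesis using z(2) \<open>0 \<le> \<eta>\<close> by simp
  qed
qed

text \<open>The Katetov extension \<open>m\<close>, the minimum of \<open>a y + d y x\<close>, takes
  its Lipschitz bound from \<open>d\<close> alone. The defect of \<open>a\<close> shows only in the
  bound on sums and in how far \<open>m\<close> falls below \<open>a\<close> on \<open>F\<close>, by
  at most \<open>\<delta>\<close> each.\<close>

lemma katetov_on_approx_extension:
  fixes d :: "'a \<Rightarrow> 'a \<Rightarrow> real"
  assumes F: "finite F" "F \<noteq> {}" "F \<subseteq> X"
    and refl: "\<And>x. x \<in> X \<Longrightarrow> d x x = 0"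
    and sym: "\<And>x y. d x y = d y x"
    and tri: "\<And>x y z. x \<in> X \<Longrightarrow> y \<in> X \<Longrightarrow> z \<in> X \<Longrightarrow> d x z \<le> d x y + d y z"
    and a: "\<And>x y. x \<in> F \<Longrightarrow> y \<in> F \<Longrightarrow> \<bar>a x - a y\<bar> \<le> d x y + \<delta> \<and> d x y \<le> a x + a y + \<delta>"
  obtains g where "katetov_on X d g" "\<And>x. x \<in> F \<Longrightarrow> \<bar>g x - a x\<bar> \<le> \<delta> / 2"
proof -
  define m where "m x = Min ((\<lambda>y. a y + d y x) ` F)" for x
  have m_in: "\<exists>y\<in>F. m x = a y + d y x" for x
  proof -
    have "m x \<in> (\<lambda>y. a y + d y x) ` F"
      unfolding m_def using F by (intro Min_in) auto
    then show ?thesis by blast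
  qed
  have m_le: "m x \<le> a y + d y x" if "y \<in> F" for x y
    using that F by (auto simp: m_def)
  have lip: "m x \<le> m z + d x z" if "x \<in> X" "z \<in> X" for x z
  proof -
    obtain y where y: "y \<in> F" "m z = a y + d y z" using m_in by blast
    have "m x \<le> a y + d y x" using m_le y by blast
    also have "\<dots> \<le> a y + (d y z + d z x)" using tri[of y z x] that y F by auto
    finally show ?thesis using y sym[of z x] by simp
  qed
  have sum: "d x z \<le> m x + m z + \<delta>" if "x \<in> X" "z \<in> X" for x z
  proof -
    obtain y where y: "y \<in> F" "m x = a y + d y x" using m_in by blast
    obtain w where w: "w \<in> F" "m z = a w + d w z" using m_in by blast
    have "d x z \<le> d x y + d y z" "d y z \<le> d y w + d w z"
      using tri that y w F by blast+
    moreover have "d y w \<le> a y + a w + \<delta>" using a y w by blast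
    ultimately show ?thesis using y w sym[of x y] by simp
  qed
  have near: "m x \<le> a x \<and> a x - \<delta> \<le> m x" if "x \<in> F" for x
  proof -
    obtain y where y: "y \<in> F" "m x = a y + d y x" using m_in by blast
    have "\<bar>a y - a x\<bar> \<le> d y x + \<delta>" using a y that by blast
    then show ?thesis using m_le[of x x] refl[of x] that F y by auto
  qed
  show thesis
  proof (rule that)
    \<comment> \<open>The shift makes up the deficit \<open>\<delta>\<close> in the sum of two
      values, and it centres the error of \<open>m\<close> on \<open>F\<close>, which lies between
      \<open>- \<delta>\<close> and 0.\<close>
    show "katetov_on X d (\<lambda>x. m x + \<delta> / 2)"
      unfolding katetov_on_def
    proof (intro ballI conjI)
      fix x y assume "x \<in> X" "y \<in> X"
      then show "\<bar>(m x + \<delta> / 2) - (m y + \<delta> / 2)\<bar> \<le> d x y"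
        using lip[of x y] lip[of y x] sym[of x y] by linarith
      show "d x y \<le> (m x + \<delta> / 2) + (m y + \<delta> / 2)"
        using sum \<open>x \<in> X\<close> \<open>y \<in> X\<close> by fastforce
    qed
    show "\<bar>m x + \<delta> / 2 - a x\<bar> \<le> \<delta> / 2" if "x \<in> F" for x
      using near[OF that] by (simp add: abs_le_iff field_simps)
  qed
qed

subsection \<open>Metric spaces\<close>

lemma mdist_self [simp]: "x \<in> mspace m \<Longrightarrow> mdist m x x = 0"
  by simp

lemma mdist_abs_diff:
  assumes "x \<in> mspace m" "y \<in> mspace m" "z \<in> mspace m"
  shows "\<bar>mdist m x z - mdist m y z\<bar> \<le> mdist m x y"
  using mdist_triangle[of x m y z] mdist_triangle[of y m x z] mdist_commute[of m x y] assms
  by linarith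

lemma mtopology_of_dense_iff:
  assumes "A \<subseteq> mspace m"
  shows "mtopology_of m closure_of A = mspace m \<longleftrightarrow>
    (\<forall>x\<in>mspace m. \<forall>e>0. \<exists>y\<in>A. mdist m x y < e)"
proof -
  interpret M: Metric_space "mspace m" "mdist m" by simp
  show ?thesis
    unfolding mtopology_of_def M.metric_closure_of M.in_mball using assms by blast
qed

lemma mcomplete_of_limit:
  assumes "mcomplete_of m" "\<And>n :: nat. s n \<in> mspace m"
    and "\<And>e. e > 0 \<Longrightarrow> \<exists>N. \<forall>i\<ge>N. \<forall>j\<ge>N. mdist m (s i) (s j) < e"
  obtains z where "z \<in> mspace m" "(\<lambda>n. mdist m (s n) z) \<longlonglongrightarrow> 0"
proof -
  interpret M: Metric_space "mspace m" "mdist m" by simp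
  have "M.MCauchy s"
    using assms(2,3) by (auto simp: M.MCauchy_def)
  then obtain z where "limitin M.mtopology s z sequentially"
    using assms(1) by (auto simp: mcomplete_of_def M.mcomplete_def)
  then show thesis
    using that by (auto simp: M.limitin_metric_dist_null)
qed

lemma mcomplete_ofI:
  assumes "\<And>s. (\<And>n :: nat. s n \<in> mspace m) \<Longrightarrow>
      (\<And>e. e > 0 \<Longrightarrow> \<exists>N. \<forall>i\<ge>N. \<forall>j\<ge>N. mdist m (s i) (s j) < e) \<Longrightarrow>
      \<exists>z\<in>mspace m. (\<lambda>n. mdist m (s n) z) \<longlonglongrightarrow> 0"
  shows "mcomplete_of m"
proof -
  interpret M: Metric_space "mspace m" "mdist m" by simp
  show ?thesis
    unfolding mcomplete_of_def M.mcomplete_def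
  proof (intro allI impI)
    fix s assume s: "M.MCauchy s"
    then have sM: "s n \<in> mspace m" for n by (auto simp: M.MCauchy_def)
    then obtain z where "z \<in> mspace m" "(\<lambda>n. mdist m (s n) z) \<longlonglongrightarrow> 0"
      using s assms[of s] by (auto simp: M.MCauchy_def)
    then show "\<exists>z. limitin M.mtopology s z sequentially"
      using sM by (auto simp: M.limitin_metric_dist_null)
  qed
qed

subsection \<open>Finite injectivity and back-and-forth\<close>

text \<open>The exact one-point extension property, characteristic of the Urysohn space among
  complete separable metric spaces. Empty \<open>F\<close> forces a point to exist; a zero value of
  \<open>a\<close> forces the point sought to lie in \<open>F\<close>.\<close>

definition finitely_injective :: "'a metric \<Rightarrow> bool" where
  "finitely_injective U \<longleftrightarrow>
     (\<forall>F a. finite F \<and> F \<subseteq> mspace U \<and> katetov_on F (mdist U) a \<longrightarrow>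
       (\<exists>z\<in>mspace U. \<forall>x\<in>F. mdist U x z = a x))"

text \<open>\<open>k\<close> lives on the whole space, so its values along the dense sequence are
  admissible at every order, and universality applies to a corner that approximates
  \<open>F\<close>. The thirds of \<open>e\<close> pay for replacing \<open>x\<close> by
  \<open>f (i x)\<close> in the distance, for the same in \<open>k\<close>, and for
  universality.\<close>

lemma completion_approx_katetov:
  assumes r: "r \<in> universal_matrices" and U: "is_completion r U f"
    and k: "katetov_on (mspace U) (mdist U) k"
    and F: "finite F" "F \<subseteq> mspace U" and e: "e > 0"
  obtains m where "\<And>x. x \<in> F \<Longrightarrow> \<bar>mdist U x (f m) - k x\<bar> < e"
proof -
  have fU: "f i \<in> mspace U" and dist: "mdist U (f i) (f j) = r i j" for i j
    using U by (auto simp: is_completion_def)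
  have "\<forall>x\<in>F. \<exists>i. mdist U x (f i) < e / 3"
  proof
    fix x assume "x \<in> F"
    moreover have "\<forall>x\<in>mspace U. \<forall>e>0. \<exists>y\<in>range f. mdist U x y < e"
      using U mtopology_of_dense_iff[of "range f" U] by (simp add: is_completion_def)
    ultimately have "\<exists>y\<in>range f. mdist U x y < e / 3"
      using F(2) e by (meson divide_pos_pos subsetD zero_less_numeral)
    then show "\<exists>i. mdist U x (f i) < e / 3" by blast
  qed
  then obtain i where i: "\<And>x. x \<in> F \<Longrightarrow> mdist U x (f (i x)) < e / 3" by metis
  \<comment> \<open>Universality speaks of initial corners, hence a bound on all chosen indices; the
    inserted 0 keeps \<open>Max\<close> meaningful for empty \<open>F\<close>.\<close>
  define n where "n = Suc (Max (insert 0 (i ` F)))"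
  have n: "i x < n" if "x \<in> F" for x
    using that F(1) by (auto simp: n_def less_Suc_eq_le)
  have "\<bar>k (f i) - k (f j)\<bar> \<le> r i j \<and> r i j \<le> k (f i) + k (f j)" for i j
    using k fU[of i] fU[of j] dist[of i j] unfolding katetov_on_def by metis
  then have "(\<lambda>j. k (f j)) \<in> admissible n r"
    by (simp add: admissible_def)
  then obtain m where m: "\<And>j. j < n \<Longrightarrow> \<bar>r j m - k (f j)\<bar> < e / 3"
  proof -
    have "\<forall>\<epsilon>>0. \<forall>n. \<forall>a\<in>admissible n r. \<exists>m. \<forall>i<n. \<bar>r i m - a i\<bar> < \<epsilon>"
      using r by (simp add: universal_matrices_def)
    from this[rule_format, OF _ \<open>(\<lambda>j. k (f j)) \<in> admissible n r\<close>, of "e / 3"]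
    show thesis using e that by auto
  qed
  show thesis
  proof
    fix x assume x: "x \<in> F"
    have "\<bar>mdist U x (f m) - mdist U (f (i x)) (f m)\<bar> \<le> mdist U x (f (i x))"
      using fU x F(2) by (intro mdist_abs_diff) auto
    moreover have "\<bar>k x - k (f (i x))\<bar> \<le> mdist U x (f (i x))"
      using k fU x F(2) by (auto simp: katetov_on_def)
    moreover have "\<bar>mdist U (f (i x)) (f m) - k (f (i x))\<bar> < e / 3"
      using m[OF n[OF x]] by (simp add: dist)
    ultimately show "\<bar>mdist U x (f m) - k x\<bar> < e"
      using i[OF x] by linarith
  qed
qed

lemma completion_finitely_injective:
  assumes r: "r \<in> universal_matrices" and U: "is_completion r U f"
  shows "finitely_injective U"
  unfolding finitely_injective_def
proof (intro allI impI, elim conjE)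
  fix F a assume F: "finite F" "F \<subseteq> mspace U" and a: "katetov_on F (mdist U) a"
  have fU: "f i \<in> mspace U" for i
    using U by (auto simp: is_completion_def)
  show "\<exists>z\<in>mspace U. \<forall>x\<in>F. mdist U x z = a x"
  proof (cases "F = {}")
    case True
    then show ?thesis using fU by auto
  next
    case False
    have approx: "\<exists>z\<in>mspace U. \<forall>x\<in>G. \<bar>mdist U x z - b x\<bar> < e"
      if G: "finite G" "G \<noteq> {}" "G \<subseteq> mspace U" and b: "katetov_on G (mdist U) b" and "e > 0"
      for G b and e :: real
    proof -
      \<comment> \<open>The case \<open>\<delta> = 0\<close> of the extension: \<open>k\<close>
        agrees with \<open>b\<close> on \<open>G\<close>.\<close>
      obtain k where k: "katetov_on (mspace U) (mdist U) k" "\<And>x. x \<in> G \<Longrightarrow> \<bar>k x - b x\<bar> \<le> 0 / 2"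
        by (rule katetov_on_approx_extension[of G "mspace U" "mdist U" b 0])
          (use G b in \<open>auto simp: katetov_on_def mdist_commute mdist_triangle\<close>)
      obtain m where "\<And>x. x \<in> G \<Longrightarrow> \<bar>mdist U x (f m) - k x\<bar> < e"
        using completion_approx_katetov[OF r U k(1) G(1,3) \<open>e > 0\<close>] by blast
      then show ?thesis using k(2) fU by (intro bexI[of _ "f m"]) auto
    qed
    \<comment> \<open>An approximate solution \<open>z\<close> is added to \<open>F\<close>, at its own error \<open>\<eta>\<close> from the point sought;
      the next approximation for the enlarged problem is then automatically close to \<open>z\<close>.\<close>
    define P where "P n z \<longleftrightarrow> z \<in> mspace U \<and> (\<forall>x\<in>F. \<bar>mdist U x z - a x\<bar> \<le> (1 / 2) ^ n)"
      for n :: nat and z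
    have "\<exists>s. \<forall>n. P n (s n) \<and> mdist U (s n) (s (Suc n)) \<le> 2 * (1 / 2) ^ n"
    proof (rule dependent_nat_choice)
      show "\<exists>z. P 0 z"
        using approx[OF F(1) False F(2) a, of 1] by (auto simp: P_def less_imp_le)
    next
      fix z n assume z: "P n z"
      define \<epsilon> :: real where "\<epsilon> = (1 / 2) ^ n"
      have zU: "z \<in> mspace U" and za: "\<And>x. x \<in> F \<Longrightarrow> \<bar>mdist U x z - a x\<bar> \<le> \<epsilon>"
        using z by (auto simp: P_def \<epsilon>_def)
      have "\<exists>b. katetov_on (insert z F) (mdist U) b \<and> (\<forall>x\<in>F. b x = a x) \<and> b z \<le> \<epsilon>"
      proof (cases "z \<in> F")
        case True
        then have "a z \<le> \<epsilon>" using za[of z] zU by simp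
        then show ?thesis using a True by (intro exI[of _ a]) (simp add: insert_absorb)
      next
        case z: False
        \<comment> \<open>The least value that the lower bounds in \<open>katetov_on_insert\<close>
          allow, hence at most \<open>\<epsilon>\<close>. It is attained at some \<open>y\<close>,
          and triangle inequalities through \<open>y\<close> give the upper bounds.\<close>
        define \<eta> where "\<eta> = Max ((\<lambda>x. \<bar>mdist U x z - a x\<bar>) ` F)"
        have "\<eta> \<in> (\<lambda>x. \<bar>mdist U x z - a x\<bar>) ` F"
          unfolding \<eta>_def using F False by (intro Max_in) auto
        then obtain y where y: "y \<in> F" "\<eta> = \<bar>mdist U y z - a y\<bar>" by blast
        have \<eta>: "\<bar>mdist U x z - a x\<bar> \<le> \<eta>" if "x \<in> F" for x
          using that F(1) by (auto simp: \<eta>_def)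
        have sum: "\<eta> \<le> a x + mdist U x z" if "x \<in> F" for x
        proof -
          have "\<bar>a x - a y\<bar> \<le> mdist U x y" "mdist U x y \<le> a x + a y"
            using a that y(1) by (auto simp: katetov_on_def)
          moreover have "\<bar>mdist U x z - mdist U y z\<bar> \<le> mdist U x y"
            using that y(1) F(2) zU by (intro mdist_abs_diff) auto
          moreover have "mdist U x y \<le> mdist U x z + mdist U y z"
            using mdist_triangle[of x U z y] mdist_commute[of U z y] that y(1) F(2) zU by auto
          ultimately show ?thesis unfolding y(2) by linarith
        qed
        moreover have "0 \<le> \<eta>" using y by simp
        ultimately have "katetov_on (insert z F) (mdist U) (a(z := \<eta>))"
          by (intro katetov_on_insert[OF a z _ mdist_commute _ \<eta> sum]) (use zU in simp_all)
        moreover have "\<eta> \<le> \<epsilon>" using y za by simp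
        ultimately show ?thesis using z by (intro exI[of _ "a(z := \<eta>)"]) auto
      qed
      then obtain b where b: "katetov_on (insert z F) (mdist U) b" "\<And>x. x \<in> F \<Longrightarrow> b x = a x"
        "b z \<le> \<epsilon>" by blast
      have "\<epsilon> > 0" by (simp add: \<epsilon>_def)
      \<comment> \<open>Tolerance \<open>\<epsilon> / 2\<close> is the bound required on
        \<open>F\<close> at \<open>Suc n\<close>; at \<open>z\<close> it gives distance below
        \<open>\<epsilon> + \<epsilon> / 2\<close>, within the allowed
        \<open>2 * \<epsilon>\<close>.\<close>
      then obtain z' where z': "z' \<in> mspace U"
        "\<And>x. x \<in> insert z F \<Longrightarrow> \<bar>mdist U x z' - b x\<bar> < \<epsilon> / 2"
        using approx[OF _ _ _ b(1), of "\<epsilon> / 2"] F zU by auto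
      have "P (Suc n) z'"
        using z' b(2) by (force simp: P_def \<epsilon>_def less_imp_le)
      moreover have "mdist U z z' \<le> 2 * (1 / 2) ^ n"
      proof -
        have "\<bar>mdist U z z' - b z\<bar> < \<epsilon> / 2" using z'(2) by blast
        then show ?thesis using b(3) \<open>\<epsilon> > 0\<close> unfolding \<epsilon>_def by linarith
      qed
      ultimately show "\<exists>y. P (Suc n) y \<and> mdist U z y \<le> 2 * (1 / 2) ^ n" by blast
    qed
    then obtain s where sP: "\<And>n. P n (s n)"
      and step: "\<And>n. mdist U (s n) (s (Suc n)) \<le> 2 * (1 / 2) ^ n" by blast
    have sU: "s n \<in> mspace U" for n using sP by (auto simp: P_def)
    \<comment> \<open>The geometric sum stays in difference form, because the bound without the
      subtracted term would not survive the induction.\<close>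
    have tail: "mdist U (s n) (s (n + k)) \<le> 4 * ((1 / 2) ^ n - (1 / 2) ^ (n + k))" for n k
    proof (induction k)
      case 0
      then show ?case using sU by simp
    next
      case (Suc k)
      have "mdist U (s n) (s (n + Suc k)) \<le> mdist U (s n) (s (n + k)) + mdist U (s (n + k)) (s (n + Suc k))"
        using sU by (intro mdist_triangle)
      then show ?case using Suc step[of "n + k"] by simp
    qed
    have tail': "mdist U (s i) (s j) \<le> 4 * (1 / 2) ^ N" if "N \<le> i" "i \<le> j" for i j N
    proof -
      have "mdist U (s i) (s j) \<le> 4 * ((1 / 2) ^ i - (1 / 2) ^ j)"
        using tail[of i "j - i"] that by simp
      also have "\<dots> \<le> 4 * (1 / 2) ^ i" by simp
      also have "\<dots> \<le> 4 * (1 / 2) ^ N" using that by (simp add: power_decreasing)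
      finally show ?thesis .
    qed
    have cauchy: "\<exists>N. \<forall>i\<ge>N. \<forall>j\<ge>N. mdist U (s i) (s j) < e" if "e > 0" for e
    proof -
      obtain N where N: "(1 / 2 :: real) ^ N < e / 4"
        by (rule exE[OF real_arch_pow_inv[of "e / 4" "1 / 2"]]) (use \<open>e > 0\<close> in auto)
      have "mdist U (s i) (s j) \<le> 4 * (1 / 2) ^ N" if "N \<le> i" "N \<le> j" for i j
        using tail'[of N i j] tail'[of N j i] that mdist_commute[of U "s i" "s j"]
        by (cases "i \<le> j") auto
      then show ?thesis using N by (intro exI[of _ N]) fastforce
    qed
    have "mcomplete_of U" using U by (simp add: is_completion_def)
    then obtain z where z: "z \<in> mspace U" and lim: "(\<lambda>n. mdist U (s n) z) \<longlonglongrightarrow> 0"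
      using mcomplete_of_limit[OF _ sU cauchy] by blast
    have "mdist U x z = a x" if x: "x \<in> F" for x
    proof -
      have "\<bar>mdist U x z - a x\<bar> \<le> mdist U (s n) z + (1 / 2) ^ n" for n
      proof -
        have "\<bar>mdist U (s n) x - mdist U z x\<bar> \<le> mdist U (s n) z"
          using sU z x F(2) by (intro mdist_abs_diff) auto
        moreover have "\<bar>mdist U x (s n) - a x\<bar> \<le> (1 / 2) ^ n"
          using sP x by (auto simp: P_def)
        ultimately show ?thesis
          using mdist_commute[of U x z] mdist_commute[of U x "s n"] by linarith
      qed
      moreover have "(\<lambda>n. mdist U (s n) z + (1 / 2) ^ n) \<longlonglongrightarrow> 0 + 0"
        by (intro tendsto_add lim LIMSEQ_power_zero) simp
      ultimately have "\<bar>mdist U x z - a x\<bar> \<le> 0"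
        by (metis (no_types, lifting) LIMSEQ_le_const add_0)
      then show ?thesis by simp
    qed
    then show ?thesis using z by blast
  qed
qed

text \<open>Partial isometries are kept as relations: the converse is again one, so a single
  extension lemma gives both forth and back, and a chain has its union as limit.\<close>

definition isometric_pairs :: "'a metric \<Rightarrow> 'b metric \<Rightarrow> ('a \<times> 'b) set \<Rightarrow> bool" where
  "isometric_pairs X Y R \<longleftrightarrow> R \<subseteq> mspace X \<times> mspace Y \<and>
     (\<forall>(x, y)\<in>R. \<forall>(x', y')\<in>R. mdist X x x' = mdist Y y y')"

lemma isometric_pairs_converse: "isometric_pairs X Y R \<Longrightarrow> isometric_pairs Y X (R\<inverse>)"
  unfolding isometric_pairs_def by fastforce

lemma converse_insert: "(insert (x, y) R)\<inverse> = insert (y, x) (R\<inverse>)"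
  by blast

text \<open>The distances from \<open>x\<close> to the domain of \<open>R\<close>, transported to
  its range, satisfy the Katetov inequalities because \<open>R\<close> preserves distances; a point
  of \<open>Y\<close> realising them can be paired with \<open>x\<close>.\<close>

lemma isometric_pairs_extend:
  assumes Y: "finitely_injective Y" and R: "isometric_pairs X Y R" "finite R" and x: "x \<in> mspace X"
  shows "\<exists>y. isometric_pairs X Y (insert (x, y) R)"
proof -
  have "\<forall>y\<in>snd ` R. \<exists>x. (x, y) \<in> R" by force
  then obtain g where g: "\<And>y. y \<in> snd ` R \<Longrightarrow> (g y, y) \<in> R" by metis
  have gX: "g y \<in> mspace X" if "y \<in> snd ` R" for y
    using g[OF that] R(1) by (auto simp: isometric_pairs_def)
  have gd: "mdist X (g y) (g y') = mdist Y y y'" if "y \<in> snd ` R" "y' \<in> snd ` R" for y y'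
    using g[OF that(1)] g[OF that(2)] R(1) by (auto simp: isometric_pairs_def)
  \<comment> \<open>Points with the same partner are at distance 0, so \<open>g\<close> inverts
    \<open>R\<close> and is not just a choice of preimages.\<close>
  have g_eq: "g y = x" if "(x, y) \<in> R" for x y
  proof -
    have "(g y, y) \<in> R" using g that by force
    then have "mdist X (g y) x = mdist Y y y" "g y \<in> mspace X" "x \<in> mspace X" "y \<in> mspace Y"
      using R(1) that by (auto simp: isometric_pairs_def)
    then show ?thesis by (metis mdist_zero)
  qed
  have "katetov_on (snd ` R) (mdist Y) (\<lambda>y. mdist X (g y) x)"
    unfolding katetov_on_def
  proof (intro ballI conjI)
    fix y y' assume y: "y \<in> snd ` R" "y' \<in> snd ` R"
    show "\<bar>mdist X (g y) x - mdist X (g y') x\<bar> \<le> mdist Y y y'"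
      using mdist_abs_diff[OF gX gX x] y gd by metis
    show "mdist Y y y' \<le> mdist X (g y) x + mdist X (g y') x"
      using mdist_triangle[OF gX[OF y(1)] x gX[OF y(2)]] gd[OF y] mdist_commute[of X x] by simp
  qed
  moreover have "finite (snd ` R)" "snd ` R \<subseteq> mspace Y"
    using R by (auto simp: isometric_pairs_def)
  ultimately obtain z where z: "z \<in> mspace Y" "\<And>y. y \<in> snd ` R \<Longrightarrow> mdist Y y z = mdist X (g y) x"
    using Y[unfolded finitely_injective_def, rule_format, of "snd ` R" "\<lambda>y. mdist X (g y) x"]
    by blast
  have "mdist Y y' z = mdist X x' x" if "(x', y') \<in> R" for x' y'
    using z(2)[of y'] g_eq[OF that] that by force
  moreover from this have "mdist X x x' = mdist Y z y'" if "(x', y') \<in> R" for x' y'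
    using that mdist_commute[of X x] mdist_commute[of Y z] by metis
  ultimately have "isometric_pairs X Y (insert (x, z) R)"
    using R(1) x z(1) unfolding isometric_pairs_def by (simp add: split_beta) auto
  then show ?thesis ..
qed

text \<open>\<open>T n\<close> is the n-th task. Each stage fulfils one task, and monotonicity
  carries every fulfilled task to the union.\<close>

lemma isometric_pairs_chain:
  assumes R0: "isometric_pairs X Y R0" "finite R0"
    and step: "\<And>n R. isometric_pairs X Y R \<Longrightarrow> finite R \<Longrightarrow>
      \<exists>R'. R \<subseteq> R' \<and> isometric_pairs X Y R' \<and> finite R' \<and> T n R'"
    and mono: "\<And>n R R'. T n R \<Longrightarrow> R \<subseteq> R' \<Longrightarrow> T n R'"
  obtains R where "isometric_pairs X Y R" "R0 \<subseteq> R" "\<And>n :: nat. T n R"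
proof -
  \<comment> \<open>The clause for \<open>n = 0\<close> pins the start of the sequence, which
    dependent choice would otherwise leave open.\<close>
  have "\<exists>S. \<forall>n. (isometric_pairs X Y (S n) \<and> finite (S n) \<and> (n = 0 \<longrightarrow> S n = R0)) \<and>
      (S n \<subseteq> S (Suc n) \<and> T n (S (Suc n)))"
  proof (rule dependent_nat_choice)
    show "\<exists>R. isometric_pairs X Y R \<and> finite R \<and> (0 = (0::nat) \<longrightarrow> R = R0)"
      using R0 by blast
  next
    fix R and n :: nat assume "isometric_pairs X Y R \<and> finite R \<and> (n = 0 \<longrightarrow> R = R0)"
    then obtain R' where "R' \<supseteq> R" "isometric_pairs X Y R'" "finite R'" "T n R'"
      using step[of R n] by blast
    then show "\<exists>R'. (isometric_pairs X Y R' \<and> finite R' \<and> (Suc n = 0 \<longrightarrow> R' = R0)) \<and>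
        (R \<subseteq> R' \<and> T n R')" by auto
  qed
  then obtain S where S: "\<And>n. isometric_pairs X Y (S n)" "S 0 = R0" "\<And>n. S n \<subseteq> S (Suc n)"
    "\<And>n. T n (S (Suc n))" by auto
  have S_mono: "S i \<subseteq> S j" if "i \<le> j" for i j
    using lift_Suc_mono_le[of S] S(3) that by blast
  show thesis
  proof (rule that)
    show "isometric_pairs X Y (\<Union>n. S n)"
      unfolding isometric_pairs_def
    proof (intro conjI ballI, safe)
      fix x y x' y' i j
      assume "(x, y) \<in> S i" "(x', y') \<in> S j"
      then have "(x, y) \<in> S (max i j)" "(x', y') \<in> S (max i j)"
        using S_mono max.cobounded1 max.cobounded2 by blast+
      then show "mdist X x x' = mdist Y y y'"
        using S(1)[of "max i j"] by (auto simp: isometric_pairs_def)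
    qed (use S(1) in \<open>auto simp: isometric_pairs_def\<close>)
    show "R0 \<subseteq> (\<Union>n. S n)" using S(2) by blast
    show "T n (\<Union>n. S n)" for n using mono[OF S(4)] by blast
  qed
qed

text \<open>The value at \<open>x\<close> is specified by its distances to all points of the range
  of \<open>R\<close>; a limit of partners of nearby points only shows that such a value exists.
  From the specification, the isometry follows by a single approximation, and \<open>h x = y\<close>
  on \<open>R\<close> because the distance is 0.\<close>

lemma isometric_pairs_imp_isometric_embedding:
  assumes R: "isometric_pairs X Y R" and Y: "mcomplete_of Y"
    and dense: "\<And>x e. x \<in> mspace X \<Longrightarrow> e > 0 \<Longrightarrow> \<exists>x'\<in>Domain R. mdist X x x' < e"
  obtains h where "isometric_embedding X Y h" "\<And>x y. (x, y) \<in> R \<Longrightarrow> h x = y"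
proof -
  have RXY: "x \<in> mspace X" "y \<in> mspace Y" if "(x, y) \<in> R" for x y
    using R that by (auto simp: isometric_pairs_def)
  have Rd: "mdist X x x' = mdist Y y y'" if "(x, y) \<in> R" "(x', y') \<in> R" for x y x' y'
    using R that by (auto simp: isometric_pairs_def)
  have "\<exists>y\<in>mspace Y. \<forall>(u, v)\<in>R. mdist Y v y = mdist X u x" if x: "x \<in> mspace X" for x
  proof -
    have "\<forall>n. \<exists>u v. (u, v) \<in> R \<and> mdist X x u < inverse (real (Suc n))"
    proof
      fix n
      have "0 < inverse (real (Suc n))" by simp
      then show "\<exists>u v. (u, v) \<in> R \<and> mdist X x u < inverse (real (Suc n))"
        using dense[OF x] by blast
    qed
    then obtain u v where uv: "\<And>n. (u n, v n) \<in> R" "\<And>n. mdist X x (u n) < inverse (real (Suc n))"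
      by metis
    have "\<exists>N. \<forall>i\<ge>N. \<forall>j\<ge>N. mdist Y (v i) (v j) < e" if "e > 0" for e
    proof -
      obtain N where N: "inverse (real (Suc N)) < e / 2"
        using reals_Archimedean[OF half_gt_zero[OF \<open>e > 0\<close>]] by blast
      have "mdist Y (v i) (v j) < e" if "i \<ge> N" "j \<ge> N" for i j
      proof -
        have "mdist Y (v i) (v j) = mdist X (u i) (u j)" using Rd uv(1) by metis
        also have "\<dots> \<le> mdist X (u i) x + mdist X x (u j)"
          using mdist_triangle RXY uv(1) x by metis
        also have "\<dots> < inverse (real (Suc i)) + inverse (real (Suc j))"
          using uv(2)[of i] uv(2)[of j] mdist_commute[of X x "u i"] by simp
        also have "\<dots> \<le> inverse (real (Suc N)) + inverse (real (Suc N))"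
          using that by (intro add_mono le_imp_inverse_le) auto
        finally show ?thesis using N by simp
      qed
      then show ?thesis by blast
    qed
    then obtain y where y: "y \<in> mspace Y" "(\<lambda>n. mdist Y (v n) y) \<longlonglongrightarrow> 0"
      using mcomplete_of_limit[OF Y, of v] RXY uv(1) by blast
    have "mdist Y b y = mdist X a x" if ab: "(a, b) \<in> R" for a b
    proof -
      have "\<bar>mdist Y b y - mdist X a x\<bar> \<le> mdist Y (v n) y + inverse (real (Suc n))" for n
      proof -
        have "\<bar>mdist Y (v n) b - mdist Y y b\<bar> \<le> mdist Y (v n) y"
          using mdist_abs_diff RXY[OF ab] RXY[OF uv(1)] y(1) by metis
        moreover have "\<bar>mdist X x a - mdist X (u n) a\<bar> \<le> mdist X x (u n)"
          using mdist_abs_diff RXY[OF ab] RXY[OF uv(1)] x by metis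
        moreover have "mdist X (u n) a = mdist Y (v n) b" using Rd[OF uv(1) ab] .
        ultimately show ?thesis
          using uv(2)[of n] mdist_commute[of X a x] mdist_commute[of Y b y] by linarith
      qed
      moreover have "(\<lambda>n. mdist Y (v n) y + inverse (real (Suc n))) \<longlonglongrightarrow> 0 + 0"
        by (intro tendsto_add y LIMSEQ_inverse_real_of_nat)
      ultimately have "\<bar>mdist Y b y - mdist X a x\<bar> \<le> 0"
        by (metis (no_types, lifting) LIMSEQ_le_const add_0)
      then show ?thesis by simp
    qed
    then show ?thesis using y(1) by blast
  qed
  then have "\<forall>x\<in>mspace X. \<exists>y. y \<in> mspace Y \<and> (\<forall>(u, v)\<in>R. mdist Y v y = mdist X u x)"
    by blast
  from bchoice[OF this] obtain h where h: "\<And>x. x \<in> mspace X \<Longrightarrow> h x \<in> mspace Y"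
    "\<And>x. x \<in> mspace X \<Longrightarrow> \<forall>(u, v)\<in>R. mdist Y v (h x) = mdist X u x" by blast
  note hY = h(1)
  have hd: "mdist Y v (h x) = mdist X u x" if "x \<in> mspace X" "(u, v) \<in> R" for x u v
    using h(2)[OF that(1)] that(2) by blast
  show thesis
  proof (rule that)
    show "isometric_embedding X Y h"
      unfolding isometric_embedding_def
    proof (intro conjI ballI funcsetI hY)
      fix x x' assume x: "x \<in> mspace X" "x' \<in> mspace X"
      have "\<bar>mdist Y (h x) (h x') - mdist X x x'\<bar> \<le> e" if "e > 0" for e
      proof -
        obtain u v where uv: "(u, v) \<in> R" "mdist X x u < e / 2"
          using dense[OF x(1), of "e / 2"] \<open>e > 0\<close> by auto
        have "\<bar>mdist Y (h x) (h x') - mdist Y v (h x')\<bar> \<le> mdist Y (h x) v"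
          using mdist_abs_diff hY x RXY[OF uv(1)] by metis
        moreover have "\<bar>mdist X x x' - mdist X u x'\<bar> \<le> mdist X x u"
          using mdist_abs_diff x RXY[OF uv(1)] by metis
        moreover have "mdist Y (h x) v = mdist X x u"
          using hd[OF x(1) uv(1)] by (simp add: mdist_commute)
        ultimately show ?thesis using hd[OF x(2) uv(1)] uv(2) by linarith
      qed
      then have "\<bar>mdist Y (h x) (h x') - mdist X x x'\<bar> \<le> 0"
        by (rule field_le_epsilon) simp
      then show "mdist Y (h x) (h x') = mdist X x x'" by simp
    qed auto
    show "h x = y" if "(x, y) \<in> R" for x y
      using hd[OF RXY(1)[OF that] that] hY RXY[OF that] by simp
  qed
qed

text \<open>The converse relation extends to an embedding \<open>g\<close> in the other direction.
  The composition of \<open>h\<close> after \<open>g\<close> is isometric and fixes the dense set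
  \<open>Range R\<close>, hence is the identity, which makes \<open>h\<close> surjective.\<close>

lemma isometric_pairs_imp_isometry:
  assumes R: "isometric_pairs X Y R" and X: "mcomplete_of X" and Y: "mcomplete_of Y"
    and dense_X: "\<And>x e. x \<in> mspace X \<Longrightarrow> e > 0 \<Longrightarrow> \<exists>x'\<in>Domain R. mdist X x x' < e"
    and dense_Y: "\<And>y e. y \<in> mspace Y \<Longrightarrow> e > 0 \<Longrightarrow> \<exists>y'\<in>Range R. mdist Y y y' < e"
  obtains h where "isometric_embedding X Y h" "h ` mspace X = mspace Y"
    "\<And>x y. (x, y) \<in> R \<Longrightarrow> h x = y"
proof -
  obtain h where h: "isometric_embedding X Y h" "\<And>x y. (x, y) \<in> R \<Longrightarrow> h x = y"
    using isometric_pairs_imp_isometric_embedding[OF R Y dense_X] by blast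
  obtain g where g: "isometric_embedding Y X g" "\<And>x y. (x, y) \<in> R \<Longrightarrow> g y = x"
    by (rule isometric_pairs_imp_isometric_embedding[OF isometric_pairs_converse[OF R] X])
      (use dense_Y in \<open>auto simp: Domain_converse\<close>)
  have hY: "h x \<in> mspace Y" if "x \<in> mspace X" for x
    using h(1) that by (auto simp: isometric_embedding_def)
  have gX: "g y \<in> mspace X" if "y \<in> mspace Y" for y
    using g(1) that by (auto simp: isometric_embedding_def)
  have "h (g y) = y" if y: "y \<in> mspace Y" for y
  proof -
    have "mdist Y (h (g y)) y \<le> e" if "e > 0" for e
    proof -
      obtain u v where uv: "(u, v) \<in> R" "mdist Y y v < e / 2"
        using dense_Y[OF y, of "e / 2"] \<open>e > 0\<close> by auto
      then have v: "v \<in> mspace Y" "u \<in> mspace X" "g v = u" "h u = v"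
        using R g(2) h(2) by (auto simp: isometric_pairs_def)
      have "mdist Y (h (g y)) v = mdist Y (h (g y)) (h u)"
        using v by simp
      also have "\<dots> = mdist X (g y) u"
        using h(1) gX[OF y] v(2) unfolding isometric_embedding_def by blast
      also have "\<dots> = mdist X (g y) (g v)"
        using v by simp
      also have "\<dots> = mdist Y y v"
        using g(1) y v(1) unfolding isometric_embedding_def by blast
      finally show ?thesis
        using mdist_triangle[of "h (g y)" Y v y] hY gX y v uv(2) mdist_commute[of Y v y] by auto
    qed
    then have "mdist Y (h (g y)) y \<le> 0"
      by (rule field_le_epsilon) simp
    then show ?thesis using hY gX y mdist_nonneg[of Y "h (g y)" y] mdist_zero[of "h (g y)" Y y] by force
  qed
  then have "h ` mspace X = mspace Y"
    using hY gX by (force simp: image_iff)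
  then show thesis using that h by blast
qed

text \<open>The tasks are the points of a countable dense set. Embedding \<open>X\<close> takes
  forth steps alone, injectivity being known for the target; homogeneity starts from the graph of
  \<open>g\<close> and alternates, so that domain and range both become dense.\<close>

lemma finitely_injective_imp_urysohn_space:
  assumes inj: "finitely_injective U" and comp: "mcomplete_of U"
    and sep: "separable_space (mtopology_of U)"
  shows "urysohn_space U"
  unfolding urysohn_space_def
proof (intro conjI allI impI comp sep; elim conjE)
  fix X :: "real metric"
  assume "mcomplete_of X" "separable_space (mtopology_of X)"
  then obtain C where C: "countable C" "C \<subseteq> mspace X" "mtopology_of X closure_of C = mspace X"
    by (auto simp: separable_space_def)
  show "\<exists>f. isometric_embedding X U f"
  proof (cases "C = {}")
    case True
    \<comment> \<open>The closure of the empty set is empty, so there is nothing to embed;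
      \<open>from_nat_into\<close> enumerates only nonempty sets.\<close>
    then show ?thesis using C by (auto simp: isometric_embedding_def)
  next
    case False
    have c: "from_nat_into C n \<in> mspace X" for n
      using C(2) from_nat_into[OF False] by blast
    obtain R where R: "isometric_pairs X U R" "\<And>n. from_nat_into C n \<in> Domain R"
    proof (rule isometric_pairs_chain[where T = "\<lambda>n R. from_nat_into C n \<in> Domain R"])
      show "isometric_pairs X U {}" by (simp add: isometric_pairs_def)
      show "\<exists>R'. R \<subseteq> R' \<and> isometric_pairs X U R' \<and> finite R' \<and> from_nat_into C n \<in> Domain R'"
        if R: "isometric_pairs X U R" "finite R" for n R
      proof -
        obtain y where "isometric_pairs X U (insert (from_nat_into C n, y) R)"
          using isometric_pairs_extend[OF inj R c] by blast
        then show ?thesis using R(2)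
          by (intro exI[of _ "insert (from_nat_into C n, y) R"]) auto
      qed
    qed auto
    have "C \<subseteq> Domain R"
      using R(2) from_nat_into_surj[OF C(1)] by blast
    then have "\<exists>x'\<in>Domain R. mdist X x x' < e" if "x \<in> mspace X" "e > 0" for x e
      using that C(3) mtopology_of_dense_iff[OF C(2)] by blast
    then show ?thesis
      using isometric_pairs_imp_isometric_embedding[OF R(1) comp] by blast
  qed
next
  fix F g assume F: "finite F" "F \<subseteq> mspace U" and g: "isometric_embedding (submetric U F) U g"
  obtain C where C: "countable C" "C \<subseteq> mspace U" "mtopology_of U closure_of C = mspace U"
    using sep by (auto simp: separable_space_def)
  show "\<exists>h. isometric_embedding U U h \<and> h ` mspace U = mspace U \<and> (\<forall>x\<in>F. h x = g x)"
  proof (cases "C = {}")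
    case True
    then show ?thesis using C F by (auto simp: isometric_embedding_def)
  next
    case False
    have c: "from_nat_into C n \<in> mspace U" for n
      using C(2) from_nat_into[OF False] by blast
    define T where "T n R \<longleftrightarrow> from_nat_into C n \<in> Domain R \<and> from_nat_into C n \<in> Range R"
      for n and R :: "('a \<times> 'a) set"
    obtain R where R: "isometric_pairs U U R" "(\<lambda>x. (x, g x)) ` F \<subseteq> R" "\<And>n. T n R"
    proof (rule isometric_pairs_chain[where T = T])
      show "isometric_pairs U U ((\<lambda>x. (x, g x)) ` F)"
        using g F(2) unfolding isometric_pairs_def isometric_embedding_def
        by (auto simp: subset_iff Pi_iff)
      show "\<exists>R'. R \<subseteq> R' \<and> isometric_pairs U U R' \<and> finite R' \<and> T n R'"
        if R: "isometric_pairs U U R" "finite R" for n R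
      proof -
        let ?c = "from_nat_into C n"
        obtain y where y: "isometric_pairs U U (insert (?c, y) R)"
          using isometric_pairs_extend[OF inj R c] by blast
        \<comment> \<open>The back step is the forth step for the converse relation.\<close>
        obtain x where "isometric_pairs U U (insert (?c, x) ((insert (?c, y) R)\<inverse>))"
          using isometric_pairs_extend[OF inj isometric_pairs_converse[OF y] _ c] R(2)
          by (meson finite.insertI finite_converse)
        from isometric_pairs_converse[OF this]
        have "isometric_pairs U U (insert (x, ?c) (insert (?c, y) R))"
          by (simp add: converse_insert)
        then show ?thesis using R(2)
          by (intro exI[of _ "insert (x, ?c) (insert (?c, y) R)"]) (auto simp: T_def)
      qed
    qed (use F in \<open>auto simp: T_def\<close>)
    have "C \<subseteq> Domain R" "C \<subseteq> Range R"
      using R(3) from_nat_into_surj[OF C(1)] unfolding T_def by blast+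
    then have "\<exists>x'\<in>Domain R. mdist U x x' < e" "\<exists>x'\<in>Range R. mdist U x x' < e"
      if "x \<in> mspace U" "e > 0" for x e
      using that C(3) mtopology_of_dense_iff[OF C(2)] by blast+
    then obtain h where "isometric_embedding U U h" "h ` mspace U = mspace U"
      "\<And>x y. (x, y) \<in> R \<Longrightarrow> h x = y"
      using isometric_pairs_imp_isometry[OF R(1) comp comp] by blast
    then show ?thesis using R(2) by blast
  qed
qed

subsection \<open>Completions\<close>

lemma distance_matricesD:
  assumes "r \<in> distance_matrices"
  shows "r i i = 0" "r i j \<ge> 0" "r i j = r j i" "r i j \<le> r i k + r k j"
  using assms unfolding distance_matrices_def by blast+

lemma is_completion_imp_separable:
  assumes "is_completion r U f"
  shows "separable_space (mtopology_of U)"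
  unfolding separable_space_def
  using assms by (intro exI[of _ "range f"]) (auto simp: is_completion_def)

lemma universal_completion_urysohn:
  assumes "r \<in> universal_matrices" "is_completion r U f"
  shows "urysohn_space U"
proof (rule finitely_injective_imp_urysohn_space)
  show "finitely_injective U" using completion_finitely_injective assms .
  show "separable_space (mtopology_of U)" using is_completion_imp_separable assms(2) .
  show "mcomplete_of U" using assms(2) by (simp add: is_completion_def)
qed

text \<open>Bounded functions on a discrete space are complete in the supremum metric, so taking a
  closure completes. Subtracting row 0 makes the rows bounded even where \<open>r\<close> is not,
  and it cancels in differences; indices at distance 0 get the same image.\<close>

lemma completion_exists:
  assumes r: "r \<in> distance_matrices"
  shows "\<exists>(U :: (nat discrete \<Rightarrow>\<^sub>C real) metric) f. is_completion r U f"
proof -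
  have r0: "r i i = 0" "r i j \<ge> 0" "r i j = r j i" "r i j \<le> r i k + r k j" for i j k
    using distance_matricesD[OF r] by blast+
  \<comment> \<open>Kuratowski embedding\<close>
  define f :: "nat \<Rightarrow> nat discrete \<Rightarrow>\<^sub>C real"
    where "f i = Bcontfun (\<lambda>k. r i (of_discrete k) - r 0 (of_discrete k))" for i
  have f: "apply_bcontfun (f i) k = r i (of_discrete k) - r 0 (of_discrete k)" for i k
  proof -
    have "\<bar>r i k - r 0 k\<bar> \<le> r i 0" for k
      using r0(3)[of i 0] r0(4)[of i k 0] r0(4)[of 0 k i] by linarith
    then have "(\<lambda>k :: nat discrete. r i (of_discrete k) - r 0 (of_discrete k)) \<in> bcontfun"
      by (intro bcontfun_normI[where b = "r i 0"]) (auto simp: continuous_on_open_vimage open_discrete)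
    then show ?thesis by (simp add: f_def Bcontfun_inverse)
  qed
  have dist_f: "dist (f i) (f j) = r i j" for i j
  proof (rule antisym)
    show "dist (f i) (f j) \<le> r i j"
    proof (rule dist_bound)
      fix k
      show "dist (f i k) (f j k) \<le> r i j"
        using r0(3)[of i j] r0(4)[of i "of_discrete k" j] r0(4)[of j "of_discrete k" i] by (simp add: f dist_real_def abs_le_iff)
    qed
    \<comment> \<open>The supremum is attained at the index \<open>j\<close>, where
      \<open>r j j = 0\<close>.\<close>
    show "r i j \<le> dist (f i) (f j)"
      using dist_bounded[of "f i" "discrete j" "f j"] r0
      by (simp add: f dist_real_def discrete_inverse)
  qed
  define U where "U = submetric euclidean_metric (closure (range f))"
  have U: "mspace U = closure (range f)" "mdist U = dist"
    by (simp_all add: U_def)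
  have "mcomplete_of U"
  proof (rule mcomplete_ofI)
    fix s assume s: "\<And>n :: nat. s n \<in> mspace U"
      "\<And>e. e > 0 \<Longrightarrow> \<exists>N. \<forall>i\<ge>N. \<forall>j\<ge>N. mdist U (s i) (s j) < e"
    then have "Cauchy s" by (auto simp: Cauchy_def U)
    then have "convergent s" by (rule Cauchy_convergent)
    then obtain z where z: "s \<longlonglongrightarrow> z" unfolding convergent_def by blast
    have "s n \<in> closure (range f)" for n using s(1)[of n] unfolding U(1) .
    then have "z \<in> mspace U"
      unfolding U(1) by (rule closed_sequentially[OF closed_closure _ z])
    moreover have "(\<lambda>n. mdist U (s n) z) \<longlonglongrightarrow> 0"
      unfolding U(2) using iffD1[OF tendsto_dist_iff z] .
    ultimately show "\<exists>z\<in>mspace U. (\<lambda>n. mdist U (s n) z) \<longlonglongrightarrow> 0" by blast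
  qed
  moreover have sub: "range f \<subseteq> mspace U"
    unfolding U(1) by (rule closure_subset)
  moreover have "mtopology_of U closure_of range f = mspace U"
    unfolding mtopology_of_dense_iff[OF sub] U(2)
  proof (intro ballI allI impI)
    fix x and \<epsilon> :: real assume "x \<in> mspace U" "\<epsilon> > 0"
    then have "\<exists>y\<in>range f. dist y x < \<epsilon>" unfolding U(1) closure_approachable by blast
    then show "\<exists>y\<in>range f. dist x y < \<epsilon>" unfolding dist_commute[of x] .
  qed
  ultimately have "is_completion r U f"
    by (simp add: is_completion_def U dist_f)
  then show ?thesis by blast
qed

text \<open>\<open>completion_is_urysohn\<close> asks for a metric on reals, so the function space
  completion is relabelled along an injection.\<close>

lemma is_completion_real:
  fixes U :: "'a metric"
  assumes U: "is_completion r U f"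
  shows "\<exists>(V :: real metric) g. is_completion r V g"
proof -
  obtain e :: "'a \<Rightarrow> real" where e: "inj_on e (mspace U)"
    using separable_metric_inj_real[OF is_completion_imp_separable[OF U]] .
  define i where "i = inv_into (mspace U) e"
  have ie: "i (e x) = x" if "x \<in> mspace U" for x
    using e that by (simp add: i_def)
  interpret V: Metric_space "e ` mspace U" "\<lambda>x y. mdist U (i x) (i y)"
    by unfold_locales (auto simp: ie mdist_commute mdist_triangle)
  have Ucomp: "mcomplete_of U" and fU: "\<And>j. f j \<in> mspace U"
    and Ud: "\<And>j k. mdist U (f j) (f k) = r j k"
    using U by (auto simp: is_completion_def)
  have dense: "\<exists>y\<in>range f. mdist U x y < \<epsilon>" if "x \<in> mspace U" "\<epsilon> > 0" for x \<epsilon>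
    using U that mtopology_of_dense_iff[of "range f" U] by (simp add: is_completion_def)
  have iV: "i y \<in> mspace U" "e (i y) = y" if "y \<in> e ` mspace U" for y
    using that by (auto simp: ie)
  have comp: "mcomplete_of V.Self"
  proof (rule mcomplete_ofI)
    fix s assume s: "\<And>n :: nat. s n \<in> mspace V.Self"
      "\<And>\<epsilon>. \<epsilon> > 0 \<Longrightarrow> \<exists>N. \<forall>i\<ge>N. \<forall>j\<ge>N. mdist V.Self (s i) (s j) < \<epsilon>"
    obtain z where z: "z \<in> mspace U" "(\<lambda>n. mdist U (i (s n)) z) \<longlonglongrightarrow> 0"
      by (rule mcomplete_of_limit[OF Ucomp, of "\<lambda>n. i (s n)"]) (use s iV in auto)
    then show "\<exists>z\<in>mspace V.Self. (\<lambda>n. mdist V.Self (s n) z) \<longlonglongrightarrow> 0"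
      by (intro bexI[of _ "e z"]) (simp_all add: ie)
  qed
  have sub: "range (\<lambda>j. e (f j)) \<subseteq> mspace V.Self"
    using fU by auto
  have "\<exists>y\<in>range (\<lambda>j. e (f j)). mdist V.Self x y < \<epsilon>" if "x \<in> mspace V.Self" "\<epsilon> > 0" for x \<epsilon>
    using dense[OF iV(1), of x \<epsilon>] that fU by (auto simp: ie)
  then have "mtopology_of V.Self closure_of range (\<lambda>j. e (f j)) = mspace V.Self"
    by (simp only: mtopology_of_dense_iff[OF sub]) blast
  then have "is_completion r V.Self (\<lambda>j. e (f j))"
    using comp sub by (simp add: is_completion_def ie fU Ud)
  then show ?thesis by blast
qed

lemma universal_completion_is_urysohn:
  assumes r: "r \<in> universal_matrices"
  shows "completion_is_urysohn r"
proof -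
  have "r \<in> distance_matrices"
    using r by (simp add: universal_matrices_def)
  then obtain U :: "(nat discrete \<Rightarrow>\<^sub>C real) metric" and f where "is_completion r U f"
    using completion_exists by blast
  then obtain V :: "real metric" and g where "is_completion r V g"
    using is_completion_real by blast
  then show ?thesis
    using universal_completion_urysohn[OF r] unfolding completion_is_urysohn_def by blast
qed

subsection \<open>Universality as a countable intersection of open dense conditions\<close>

lemma tendsto_fun_iff:
  fixes f :: "'a \<Rightarrow> 'b \<Rightarrow> 'c::topological_space"
  shows "(f \<longlongrightarrow> l) F \<longleftrightarrow> (\<forall>i. ((\<lambda>x. f x i) \<longlongrightarrow> l i) F)"
  using limitin_componentwise[of "\<lambda>_::'b. euclidean :: 'c topology" UNIV f l F]
  by (simp add: euclidean_product_topology)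

lemma continuous_on_entry [continuous_intros]: "continuous_on S (\<lambda>r :: nat \<Rightarrow> nat \<Rightarrow> real. r i j)"
proof -
  have "continuous_on UNIV (\<lambda>r :: nat \<Rightarrow> nat \<Rightarrow> real. r i j)"
    by (rule continuous_on_product_then_coordinatewise[OF continuous_on_product_coordinates])
  then show ?thesis by (rule continuous_on_subset) simp
qed

lemma closed_distance_matrices: "closed distance_matrices"
  unfolding distance_matrices_def
  by (intro closed_Collect_all closed_Collect_conj closed_Collect_eq closed_Collect_le continuous_intros)

text \<open>One list of rationals packs the entries together with their number, so that the pairs
  \<open>(q, N)\<close> below form a countable type.\<close>

definition near_admissible :: "rat list \<Rightarrow> real \<Rightarrow> (nat \<Rightarrow> nat \<Rightarrow> real) \<Rightarrow> bool" where
  "near_admissible q \<delta> r \<longleftrightarrow> (\<forall>i<length q. \<forall>j<length q.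
     \<bar>of_rat (q ! i) - of_rat (q ! j)\<bar> \<le> r i j + \<delta> \<and> r i j \<le> of_rat (q ! i) + of_rat (q ! j) + \<delta>)"

text \<open>The corner of \<open>r\<close> may admit no rational admissible vectors at all. Relaxing
  admissibility by \<open>\<delta>\<close> leaves countably many conditions, each open because the relaxed
  admissibility is closed in \<open>r\<close>.\<close>

definition extension_set :: "rat list \<times> nat \<Rightarrow> (nat \<Rightarrow> nat \<Rightarrow> real) set" where
  "extension_set = (\<lambda>(q, N). {r. near_admissible q (inverse (real (Suc N))) r \<longrightarrow>
     (\<exists>m. \<forall>i<length q. \<bar>r i m - of_rat (q ! i)\<bar> < 2 * inverse (real (Suc N)))})"

lemma open_extension_set: "open (extension_set p)"
proof -
  obtain q N where p: "p = (q, N)" by fastforce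
  have "open {r :: nat \<Rightarrow> nat \<Rightarrow> real. \<forall>i<length q. \<bar>r i m - of_rat (q ! i)\<bar> < c}" for m c
  proof -
    have "{r :: nat \<Rightarrow> nat \<Rightarrow> real. \<forall>i<length q. \<bar>r i m - of_rat (q ! i)\<bar> < c} =
        (\<Inter>i\<in>{..<length q}. {r. \<bar>r i m - of_rat (q ! i)\<bar> < c})" by auto
    also have "open \<dots>"
      by (intro open_INT finite_lessThan ballI open_Collect_less continuous_intros)
    finally show ?thesis .
  qed
  then show ?thesis
    unfolding p extension_set_def near_admissible_def split
    by (intro open_Collect_imp open_Collect_ex closed_Collect_all closed_Collect_imp
        closed_Collect_conj closed_Collect_le open_Collect_const continuous_intros)
qed

text \<open>Turns relaxed rational data into a genuine Katetov function. Being defined on all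
  indices, \<open>g\<close> is admissible at every order, as the growing corners of the density
  argument require.\<close>

lemma near_admissible_imp_katetov:
  assumes r: "r \<in> distance_matrices" and q: "near_admissible q \<delta> r"
  obtains g where "katetov_on UNIV r g" "\<And>i. i < length q \<Longrightarrow> \<bar>g i - of_rat (q ! i)\<bar> \<le> \<delta> / 2"
proof (cases "q = []")
  case True
  have "katetov_on UNIV r (r 0)"
    unfolding katetov_on_def
  proof (intro ballI conjI)
    fix i j
    show "\<bar>r 0 i - r 0 j\<bar> \<le> r i j" "r i j \<le> r 0 i + r 0 j"
      using distance_matricesD[OF r] by (smt (verit))+
  qed
  then show thesis using that True by simp
next
  case False
  show thesis
  proof (rule katetov_on_approx_extension[of "{..<length q}" UNIV r "\<lambda>i. of_rat (q ! i)" \<delta>])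
    show "\<And>g. katetov_on UNIV r g \<Longrightarrow>
        (\<And>x. x \<in> {..<length q} \<Longrightarrow> \<bar>g x - of_rat (q ! x)\<bar> \<le> \<delta> / 2) \<Longrightarrow> thesis"
      using that by auto
    show "r i k \<le> r i j + r j k" "r i j = r j i" for i j k
      using distance_matricesD[OF r] by blast+
  qed (use False q distance_matricesD(1)[OF r] in \<open>auto simp: near_admissible_def\<close>)
qed

lemma universal_matrices_eq:
  "universal_matrices = distance_matrices \<inter> (\<Inter>p. extension_set p)"
proof (intro set_eqI iffI)
  fix r assume r: "r \<in> universal_matrices"
  then have rD: "r \<in> distance_matrices"
    and univ: "\<And>\<epsilon> n a. \<epsilon> > 0 \<Longrightarrow> a \<in> admissible n r \<Longrightarrow> \<exists>m. \<forall>i<n. \<bar>r i m - a i\<bar> < \<epsilon>"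
    by (auto simp: universal_matrices_def)
  have "r \<in> extension_set p" for p
  proof -
    obtain q N where p: "p = (q, N)" by fastforce
    define \<delta> where "\<delta> = inverse (real (Suc N))"
    have \<delta>: "\<delta> > 0" by (simp add: \<delta>_def)
    have "\<exists>m. \<forall>i<length q. \<bar>r i m - of_rat (q ! i)\<bar> < 2 * \<delta>" if "near_admissible q \<delta> r"
    proof -
      obtain g where g: "katetov_on UNIV r g"
        "\<And>i. i < length q \<Longrightarrow> \<bar>g i - of_rat (q ! i)\<bar> \<le> \<delta> / 2"
        using near_admissible_imp_katetov[OF rD \<open>near_admissible q \<delta> r\<close>] by blast
      have "g \<in> admissible (length q) r"
        using g(1) by (simp add: admissible_iff_katetov_on katetov_on_def)
      then obtain m where m: "\<And>i. i < length q \<Longrightarrow> \<bar>r i m - g i\<bar> < \<delta>"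
        using univ[OF \<delta>] by blast
      \<comment> \<open>Repairing \<open>q\<close> costs \<open>\<delta> / 2\<close> and
        universality less than \<open>\<delta>\<close>, which fits into
        \<open>2 * \<delta>\<close>.\<close>
      have "\<bar>r i m - of_rat (q ! i)\<bar> < 2 * \<delta>" if "i < length q" for i
        using m[OF that] g(2)[OF that] \<delta> by linarith
      then show ?thesis by blast
    qed
    then show ?thesis by (simp add: p extension_set_def \<delta>_def)
  qed
  then show "r \<in> distance_matrices \<inter> (\<Inter>p. extension_set p)" using rD by blast
next
  fix r assume r: "r \<in> distance_matrices \<inter> (\<Inter>p. extension_set p)"
  have "\<exists>m. \<forall>i<n. \<bar>r i m - a i\<bar> < \<epsilon>" if "\<epsilon> > 0" and a: "a \<in> admissible n r" for \<epsilon> n a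
  proof -
    \<comment> \<open>A third of \<open>\<epsilon>\<close> leaves room for the tolerance
      \<open>2 * \<delta>\<close> of the condition and the rounding error
      \<open>\<delta> / 2\<close>.\<close>
    obtain N where N: "inverse (real (Suc N)) < \<epsilon> / 3"
      using reals_Archimedean[of "\<epsilon> / 3"] \<open>\<epsilon> > 0\<close> by (metis divide_pos_pos zero_less_numeral)
    define \<delta> where "\<delta> = inverse (real (Suc N))"
    have \<delta>: "\<delta> > 0" "\<delta> < \<epsilon> / 3" using N by (simp_all add: \<delta>_def)
    \<comment> \<open>Each relaxed inequality involves two entries, so rounding may use half of
      \<open>\<delta>\<close>.\<close>
    have "\<exists>x. \<bar>of_rat x - a i\<bar> < \<delta> / 2" for i
    proof -
      obtain x where "a i - \<delta> / 2 < of_rat x" "of_rat x < a i + \<delta> / 2"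
        using of_rat_dense[of "a i - \<delta> / 2" "a i + \<delta> / 2"] \<delta>(1) by auto
      then show ?thesis by (intro exI[of _ x]) linarith
    qed
    then obtain x where x: "\<And>i. \<bar>of_rat (x i) - a i\<bar> < \<delta> / 2" by metis
    define q where "q = map x [0..<n]"
    have q: "length q = n" "\<And>i. i < n \<Longrightarrow> q ! i = x i" by (simp_all add: q_def)
    have "near_admissible q \<delta> r"
      unfolding near_admissible_def q(1)
    proof (intro allI impI)
      fix i j assume ij: "i < n" "j < n"
      then have "\<bar>a i - a j\<bar> \<le> r i j" "r i j \<le> a i + a j"
        using a by (auto simp: admissible_def)
      then show "\<bar>of_rat (q ! i) - of_rat (q ! j)\<bar> \<le> r i j + \<delta> \<and>
          r i j \<le> of_rat (q ! i) + of_rat (q ! j) + \<delta>"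
        using x[of i] x[of j] unfolding q(2)[OF ij(1)] q(2)[OF ij(2)] by linarith
    qed
    moreover have "r \<in> extension_set (q, N)" using r by blast
    ultimately obtain m where m: "\<And>i. i < n \<Longrightarrow> \<bar>r i m - of_rat (q ! i)\<bar> < 2 * \<delta>"
      by (auto simp: extension_set_def \<delta>_def q(1))
    have "\<bar>r i m - a i\<bar> < \<epsilon>" if "i < n" for i
      using m[OF that] x[of i] \<delta>(2) unfolding q(2)[OF that] by linarith
    then show ?thesis by blast
  qed
  then show "r \<in> universal_matrices"
    using r by (auto simp: universal_matrices_def)
qed

section \<open>Density of the conditions and the Baire category argument\<close>

lemma dense_extension_set: "distance_matrices \<subseteq> closure (distance_matrices \<inter> extension_set p)"
proof
  fix r assume r: "r \<in> distance_matrices"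
  obtain q N where p: "p = (q, N)" by fastforce
  define \<delta> where "\<delta> = inverse (real (Suc N))"
  have \<delta>: "\<delta> > 0" by (simp add: \<delta>_def)
  show "r \<in> closure (distance_matrices \<inter> extension_set p)"
  proof (cases "near_admissible q \<delta> r")
    case False
    then have "r \<in> extension_set p" by (simp add: p extension_set_def \<delta>_def)
    then have "r \<in> distance_matrices \<inter> extension_set p" using r by blast
    then show ?thesis by (rule subsetD[OF closure_subset])
  next
    case True
    obtain g where g: "katetov_on UNIV r g"
      "\<And>i. i < length q \<Longrightarrow> \<bar>g i - of_rat (q ! i)\<bar> \<le> \<delta> / 2"
      using near_admissible_imp_katetov[OF r True] by blast
    \<comment> \<open>The corner of order \<open>M\<close> is kept, and all further points are copies of one new point
      whose distances to the corner are given by \<open>g\<close>.\<close>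
    define R where "R M i j =
      (if i < M then if j < M then r i j else g i else if j < M then g j else 0)" for M i j :: nat
    have g_ge: "g i \<ge> 0" and g_lip: "g i \<le> g j + r i j" and g_sum: "r i j \<le> g i + g j" for i j
    proof -
      have "\<bar>g i - g j\<bar> \<le> r i j" "r i j \<le> g i + g j" "r i i \<le> g i + g i"
        using g(1) unfolding katetov_on_def by blast+
      then show "g i \<ge> 0" "g i \<le> g j + r i j" "r i j \<le> g i + g j"
        using distance_matricesD(1)[OF r, of i] by linarith+
    qed
    have "R M \<in> distance_matrices" for M
    proof -
      note rD = distance_matricesD[OF r]
      have "R M i j \<le> R M i k + R M k j" for i j k
        using rD(4)[of i j k] g_lip[of i k] g_lip[of j k] rD(3)[of k j] g_sum[of i j]
          g_ge[of i] g_ge[of j] g_ge[of k]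
        by (simp add: R_def)
      moreover have "R M i j = R M j i" for i j
        using rD(3)[of i j] by (simp add: R_def)
      ultimately show ?thesis
        using rD(1,2) g_ge by (auto simp: distance_matrices_def R_def)
    qed
    moreover have "R M \<in> extension_set p" if "M \<ge> length q" for M
    proof -
      \<comment> \<open>The index \<open>M\<close> is the first copy of the new point and serves as
        the witness.\<close>
      have "\<bar>R M i M - of_rat (q ! i)\<bar> < 2 * \<delta>" if "i < length q" for i
        using g(2)[OF that] \<delta> that \<open>M \<ge> length q\<close> by (auto simp: R_def)
      then show ?thesis by (auto simp: p extension_set_def \<delta>_def)
    qed
    ultimately have "R (M + length q) \<in> distance_matrices \<inter> extension_set p" for M by simp
    moreover have "(\<lambda>M. R (M + length q)) \<longlonglongrightarrow> r"
      unfolding tendsto_fun_iff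
    proof (intro allI)
      fix i j
      have "\<forall>\<^sub>F M in sequentially. R (M + length q) i j = r i j"
        using eventually_gt_at_top[of "max i j"] by eventually_elim (auto simp: R_def)
      then show "(\<lambda>M. R (M + length q) i j) \<longlonglongrightarrow> r i j"
        by (rule tendsto_eventually)
    qed
    ultimately show ?thesis
      unfolding closure_sequential by (intro exI[of _ "\<lambda>M. R (M + length q)"]) simp
  qed
qed

text \<open>Adding a positive constant to all off-diagonal entries keeps the triangle inequality: if
  \<open>i\<close> and \<open>j\<close> differ, at least one of the two other sides is off the
  diagonal and gains the constant too.\<close>

lemma dense_entry_nonzero:
  assumes "i \<noteq> j"
  shows "distance_matrices \<subseteq> closure (distance_matrices \<inter> {r. r i j \<noteq> 0})"
proof
  fix r assume r: "r \<in> distance_matrices"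
  note rD = distance_matricesD[OF r]
  define R where "R k i j = (if i = j then 0 else r i j + inverse (real (Suc k)))" for k i j :: nat
  have "R k \<in> distance_matrices" for k
  proof -
    define c where "c = inverse (real (Suc k))"
    have c: "c > 0" by (simp add: c_def)
    have "R k i j \<le> R k i l + R k l j" for i j l
      using rD(2)[of i j] rD(4)[of i j l] rD(2)[of l j] rD(2)[of i l] c
      unfolding R_def c_def[symmetric] by auto
    moreover have "R k i j = R k j i" for i j
      using rD(3)[of i j] by (simp add: R_def)
    ultimately show ?thesis
      using rD(1,2) by (auto simp: distance_matrices_def R_def)
  qed
  moreover have "R k i j \<noteq> 0" for k
  proof -
    have "inverse (real (Suc k)) > 0" by simp
    then have "r i j + inverse (real (Suc k)) \<noteq> 0" using rD(2)[of i j] by linarith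
    then show ?thesis using assms by (simp add: R_def)
  qed
  moreover have "R \<longlonglongrightarrow> r"
    unfolding tendsto_fun_iff
  proof (intro allI)
    fix i j
    have "(\<lambda>k. r i j + inverse (real (Suc k))) \<longlonglongrightarrow> r i j + 0"
      by (intro tendsto_add tendsto_const LIMSEQ_inverse_real_of_nat)
    then show "(\<lambda>k. R k i j) \<longlonglongrightarrow> r i j"
      by (cases "i = j") (simp_all add: R_def rD(1))
  qed
  ultimately show "r \<in> closure (distance_matrices \<inter> {r. r i j \<noteq> 0})"
    unfolding closure_sequential by blast
qed

text \<open>Closed in a completely metrizable space, \<open>distance_matrices\<close> is itself a
  Baire space; the category theorem is applied to the traces of the sets \<open>V\<close> on
  it.\<close>

lemma distance_matrices_Baire:
  assumes "countable \<O>" and "\<And>V. V \<in> \<O> \<Longrightarrow> open V"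
    and dense: "\<And>V. V \<in> \<O> \<Longrightarrow> distance_matrices \<subseteq> closure (distance_matrices \<inter> V)"
  shows "distance_matrices \<subseteq> closure (distance_matrices \<inter> \<Inter>\<O>)"
proof -
  let ?X = "top_of_set distance_matrices"
  have "?X closure_of \<Inter>((\<inter>) distance_matrices ` \<O>) = topspace ?X"
  proof (rule Baire_category)
    show "completely_metrizable_space ?X \<or> locally_compact_space ?X \<and> regular_space ?X"
      using completely_metrizable_space_closedin[OF completely_metrizable_space_euclidean]
        closed_distance_matrices unfolding closed_closedin by blast
    fix T assume "T \<in> (\<inter>) distance_matrices ` \<O>"
    then obtain V where V: "V \<in> \<O>" "T = distance_matrices \<inter> V" by blast
    then show "openin ?X T \<and> ?X closure_of T = topspace ?X"
      using assms(2)[of V] dense[of V]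
      by (auto simp: closure_of_subtopology openin_open Int_absorb1)
  qed (use assms in auto)
  moreover have "distance_matrices \<inter> \<Inter>((\<inter>) distance_matrices ` \<O>) = distance_matrices \<inter> \<Inter>\<O>"
    by blast
  ultimately have "distance_matrices \<inter> closure (distance_matrices \<inter> \<Inter>\<O>) = distance_matrices"
    by (simp only: closure_of_subtopology euclidean_closure_of topspace_euclidean_subtopology)
  then show ?thesis by blast
qed

subsection \<open>The weak topology\<close>

lemma matrix_measuresD:
  assumes "\<nu> \<in> matrix_measures"
  shows "prob_space \<nu>" "sets \<nu> = sets (restrict_space borel distance_matrices)"
    "space \<nu> = distance_matrices"
proof -
  show "prob_space \<nu>" and s: "sets \<nu> = sets (restrict_space borel distance_matrices)"
    using assms by (auto simp: matrix_measures_def)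
  show "space \<nu> = distance_matrices"
    using sets_eq_imp_space_eq[OF s] by (simp add: space_restrict_space)
qed

lemma borel_measurable_matrix_measure:
  assumes "\<nu> \<in> matrix_measures" "continuous_on distance_matrices f"
  shows "f \<in> borel_measurable \<nu>"
  using borel_measurable_continuous_on_restrict[OF assms(2)]
    measurable_cong_sets[OF matrix_measuresD(2)[OF assms(1)] refl] by blast

lemma sets_matrix_measure:
  assumes "\<nu> \<in> matrix_measures" "A \<in> sets borel"
  shows "distance_matrices \<inter> A \<in> sets \<nu>" "distance_matrices - A \<in> sets \<nu>"
proof -
  show "distance_matrices \<inter> A \<in> sets \<nu>"
    using assms(2) by (auto simp: matrix_measuresD(2)[OF assms(1)] sets_restrict_space)
  then have "space \<nu> - distance_matrices \<inter> A \<in> sets \<nu>" by blast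
  then show "distance_matrices - A \<in> sets \<nu>"
    by (simp add: matrix_measuresD(3)[OF assms(1)] Diff_Int)
qed

lemma open_indicator_approx:
  fixes S :: "'a::metric_space set"
  assumes "open S"
  obtains f :: "nat \<Rightarrow> 'a \<Rightarrow> real" where "\<And>j. continuous_on UNIV (f j)"
    "\<And>j x. 0 \<le> f j x" "\<And>j x. f j x \<le> indicator S x" "\<And>x. (\<lambda>j. f j x) \<longlonglongrightarrow> indicator S x"
proof (cases "S = UNIV")
  case True
  \<comment> \<open>\<open>infdist\<close> from the empty set is 0, so the formula of the other case
    would give the zero function here.\<close>
  show thesis by (rule that[of "\<lambda>_ _. 1"]) (simp_all add: True)
next
  case False
  define f where "f j x = min 1 (real j * infdist x (- S))" for j x
  show thesis
  proof (rule that[of f])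
    show "continuous_on UNIV (f j)" for j
      unfolding f_def by (intro continuous_intros)
    show "0 \<le> f j x" for j x
      by (simp add: f_def infdist_nonneg)
    show "f j x \<le> indicator S x" for j x
      by (cases "x \<in> S") (simp_all add: f_def)
    show "(\<lambda>j. f j x) \<longlonglongrightarrow> indicator S x" for x
    proof (cases "x \<in> S")
      case True
      then have pos: "infdist x (- S) > 0"
        using infdist_pos_not_in_closed[of "- S" x] assms False by auto
      obtain N where "1 < real N * infdist x (- S)"
        using reals_Archimedean3[OF pos] by blast
      then have ge: "1 \<le> real j * infdist x (- S)" if "j \<ge> N" for j
        using that mult_right_mono[of "real N" "real j" "infdist x (- S)"] pos by linarith
      have "\<forall>\<^sub>F j in sequentially. f j x = indicator S x"
        using ge True by (intro eventually_sequentiallyI[of N]) (simp add: f_def)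
      then show ?thesis by (rule tendsto_eventually)
    qed (simp add: f_def)
  qed
qed

text \<open>The open-set half of the portmanteau theorem: the measure of \<open>S\<close> is the
  supremum of the integrals of continuous functions below its indicator, so the set is a union of
  subbasic ones.\<close>

lemma openin_weak_topology_measure_gt:
  assumes S: "open S"
  shows "openin weak_topology {\<nu> \<in> matrix_measures. c < measure \<nu> (distance_matrices \<inter> S)}"
proof -
  obtain f :: "nat \<Rightarrow> _ \<Rightarrow> real" where f: "\<And>j. continuous_on UNIV (f j)" "\<And>j x. 0 \<le> f j x"
    "\<And>j x. f j x \<le> indicator S x" "\<And>x. (\<lambda>j. f j x) \<longlonglongrightarrow> indicator S x"
    using open_indicator_approx[OF S] by blast
  have f1: "f j x \<le> 1" for j x
    using f(3)[of j x] by (cases "x \<in> S") auto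
  have fD: "continuous_on distance_matrices (f j)" for j
    using f(1) by (rule continuous_on_subset) simp
  have "c < measure \<nu> (distance_matrices \<inter> S) \<longleftrightarrow> (\<exists>j. c < (\<integral>r. f j r \<partial>\<nu>))"
    if \<nu>: "\<nu> \<in> matrix_measures" for \<nu>
  proof -
    interpret prob_space \<nu> using matrix_measuresD(1)[OF \<nu>] .
    have f_meas: "f j \<in> borel_measurable \<nu>" for j
      using borel_measurable_matrix_measure[OF \<nu> fD] .
    have S_sets: "distance_matrices \<inter> S \<in> sets \<nu>"
      using sets_matrix_measure[OF \<nu>] S by simp
    have S_meas: "(indicator S :: _ \<Rightarrow> real) \<in> borel_measurable \<nu>"
      using S_sets by (simp add: borel_measurable_indicator_iff matrix_measuresD(3)[OF \<nu>] Int_commute)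
    have S_int: "(\<integral>r. indicator S r \<partial>\<nu>) = measure \<nu> (distance_matrices \<inter> S)"
      by (simp add: matrix_measuresD(3)[OF \<nu>] Int_commute)
    have f_int: "integrable \<nu> (f j)" for j
      by (rule integrable_const_bound[where B = 1]) (use f(2) f1 f_meas in auto)
    have I_int: "integrable \<nu> (indicator S :: _ \<Rightarrow> real)"
      by (rule integrable_const_bound[where B = 1]) (use S_meas in \<open>auto simp: indicator_def\<close>)
    have "(\<lambda>j. \<integral>r. f j r \<partial>\<nu>) \<longlonglongrightarrow> (\<integral>r. indicator S r \<partial>\<nu>)"
      by (rule integral_dominated_convergence[where w = "\<lambda>_. 1"])
        (use f(2,4) f1 f_meas S_meas in auto)
    then have lim: "(\<lambda>j. \<integral>r. f j r \<partial>\<nu>) \<longlonglongrightarrow> measure \<nu> (distance_matrices \<inter> S)"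
      by (simp only: S_int)
    have le: "(\<integral>r. f j r \<partial>\<nu>) \<le> measure \<nu> (distance_matrices \<inter> S)" for j
      unfolding S_int[symmetric] by (intro integral_mono f_int I_int f(3))
    show ?thesis
    proof
      assume "c < measure \<nu> (distance_matrices \<inter> S)"
      then have "\<forall>\<^sub>F j in sequentially. c < (\<integral>r. f j r \<partial>\<nu>)"
        using order_tendstoD(1)[OF lim] by blast
      then show "\<exists>j. c < (\<integral>r. f j r \<partial>\<nu>)"
        by (rule eventually_happens'[OF sequentially_bot])
    next
      assume "\<exists>j. c < (\<integral>r. f j r \<partial>\<nu>)"
      then show "c < measure \<nu> (distance_matrices \<inter> S)"
        using le less_le_trans by blast
    qed
  qed
  then have "{\<nu> \<in> matrix_measures. c < measure \<nu> (distance_matrices \<inter> S)} =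
      (\<Union>j. {\<nu> \<in> matrix_measures. (\<integral>r. f j r \<partial>\<nu>) \<in> {c<..}})" by auto
  moreover have "openin weak_topology {\<nu> \<in> matrix_measures. (\<integral>r. f j r \<partial>\<nu>) \<in> {c<..}}" for j
    unfolding weak_topology_def
  proof (intro topology_generated_by_Basis CollectI exI conjI)
    show "bounded (f j ` distance_matrices)"
      using f(2) f1 by (intro boundedI[where B = 1]) auto
  qed (use fD in auto)
  ultimately show ?thesis by auto
qed

text \<open>Reduces density to convergence of integrals along one sequence: finite intersections and
  unions preserve eventual membership in the subbasic sets.\<close>

lemma eventually_in_weakly_open:
  assumes W: "openin weak_topology W" "\<nu> \<in> W"
    and \<mu>: "\<And>n :: nat. \<mu> n \<in> matrix_measures"
    and lim: "\<And>f :: _ \<Rightarrow> real. continuous_on distance_matrices f \<Longrightarrow> bounded (f ` distance_matrices) \<Longrightarrow>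
      (\<lambda>n. \<integral>r. f r \<partial>\<mu> n) \<longlonglongrightarrow> (\<integral>r. f r \<partial>\<nu>)"
  shows "\<forall>\<^sub>F n in sequentially. \<mu> n \<in> W"
  using openin_topology_generated_by[OF W(1)[unfolded weak_topology_def]] W(2)
proof induction
  case (Int a b)
  then show ?case by (simp add: eventually_conj_iff)
next
  case (UN K)
  then obtain k where "k \<in> K" "\<forall>\<^sub>F n in sequentially. \<mu> n \<in> k" by blast
  then show ?case by (auto elim: eventually_mono)
next
  case (Basis s)
  then obtain f W where f: "s = {\<nu> \<in> matrix_measures. (\<integral>r. f r \<partial>\<nu>) \<in> W}"
    "continuous_on distance_matrices f" "bounded (f ` distance_matrices)" "open (W :: real set)"
    by blast
  then have "\<forall>\<^sub>F n in sequentially. (\<integral>r. f r \<partial>\<mu> n) \<in> W"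
    using topological_tendstoD[OF lim] Basis.prems by blast
  then show ?case using \<mu> by (auto simp: f(1) elim: eventually_mono)
qed simp

subsection \<open>Measures concentrated on a set\<close>

text \<open>The set is a parameter because two are needed: the universal matrices, and those among
  them with nonzero off-diagonal entries.\<close>

definition concentrated_on :: "(nat \<Rightarrow> nat \<Rightarrow> real) set \<Rightarrow> (nat \<Rightarrow> nat \<Rightarrow> real) measure set" where
  "concentrated_on S = {\<nu> \<in> matrix_measures. distance_matrices - S \<in> null_sets \<nu>}"

text \<open>Full measure is a countable conjunction of strict lower bounds on the measure of
  \<open>S\<close>.\<close>

lemma gdelta_in_concentrated_on_open:
  assumes S: "open S"
  shows "gdelta_in weak_topology (concentrated_on S)"
proof -
  have "\<nu> \<in> concentrated_on S \<longleftrightarrow>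
      (\<forall>N. 1 - inverse (real (Suc N)) < measure \<nu> (distance_matrices \<inter> S))"
    if \<nu>: "\<nu> \<in> matrix_measures" for \<nu>
  proof -
    interpret prob_space \<nu> using matrix_measuresD(1)[OF \<nu>] .
    have sets: "distance_matrices \<inter> S \<in> sets \<nu>" "distance_matrices - S \<in> sets \<nu>"
      using sets_matrix_measure[OF \<nu>, of S] S by auto
    have "measure \<nu> (distance_matrices - S) = 1 - measure \<nu> (distance_matrices \<inter> S)"
      using prob_compl[OF sets(1)] by (simp add: matrix_measuresD(3)[OF \<nu>] Diff_Int)
    then have "\<nu> \<in> concentrated_on S \<longleftrightarrow> measure \<nu> (distance_matrices \<inter> S) = 1"
      using sets(2) \<nu> by (auto simp: concentrated_on_def null_sets_def emeasure_eq_measure)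
    also have "\<dots> \<longleftrightarrow> (\<forall>N. 1 - inverse (real (Suc N)) < measure \<nu> (distance_matrices \<inter> S))"
    proof
      assume *: "\<forall>N. 1 - inverse (real (Suc N)) < measure \<nu> (distance_matrices \<inter> S)"
      have "1 \<le> measure \<nu> (distance_matrices \<inter> S)"
      proof (rule ccontr)
        assume "\<not> 1 \<le> measure \<nu> (distance_matrices \<inter> S)"
        then obtain N where "inverse (real (Suc N)) < 1 - measure \<nu> (distance_matrices \<inter> S)"
          using reals_Archimedean[of "1 - measure \<nu> (distance_matrices \<inter> S)"] by fastforce
        then show False using *[rule_format, of N] by linarith
      qed
      then show "measure \<nu> (distance_matrices \<inter> S) = 1"
        using prob_le_1 by (simp add: antisym)
    qed simp
    finally show ?thesis .
  qed
  moreover have "concentrated_on S \<subseteq> matrix_measures" by (auto simp: concentrated_on_def)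
  ultimately have "concentrated_on S =
      (\<Inter>N. {\<nu> \<in> matrix_measures. 1 - inverse (real (Suc N)) < measure \<nu> (distance_matrices \<inter> S)})"
    by blast
  then show ?thesis
    using openin_weak_topology_measure_gt[OF S]
    by (simp only:) (intro gdelta_in_Inter; auto intro: open_imp_gdelta_in)
qed

text \<open>The complement of the intersection is a countable union of null sets. For an empty
  family the right-hand side would also contain measures outside
  \<open>matrix_measures\<close>.\<close>

lemma concentrated_on_Inter:
  assumes "countable \<O>" "\<O> \<noteq> {}"
    and "\<And>V. V \<in> \<O> \<Longrightarrow> open V"
  shows "concentrated_on (\<Inter>\<O>) = (\<Inter>V\<in>\<O>. concentrated_on V)"
proof (intro set_eqI iffI)
  fix \<nu> assume \<nu>: "\<nu> \<in> concentrated_on (\<Inter>\<O>)"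
  show "\<nu> \<in> (\<Inter>V\<in>\<O>. concentrated_on V)"
  proof
    fix V assume V: "V \<in> \<O>"
    have "\<nu> \<in> matrix_measures" "distance_matrices - \<Inter>\<O> \<in> null_sets \<nu>"
      using \<nu> by (auto simp: concentrated_on_def)
    moreover from this have "distance_matrices - V \<in> sets \<nu>"
      using sets_matrix_measure(2)[of \<nu> V] assms(3)[OF V] by simp
    moreover have "distance_matrices - V \<subseteq> distance_matrices - \<Inter>\<O>" using V by blast
    ultimately show "\<nu> \<in> concentrated_on V"
      using null_sets_subset by (auto simp: concentrated_on_def)
  qed
next
  fix \<nu> assume \<nu>: "\<nu> \<in> (\<Inter>V\<in>\<O>. concentrated_on V)"
  have "distance_matrices - \<Inter>\<O> = (\<Union>V\<in>\<O>. distance_matrices - V)" by blast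
  also have "\<dots> \<in> null_sets \<nu>"
    using \<nu> by (intro null_sets_UN' assms(1)) (auto simp: concentrated_on_def)
  finally show "\<nu> \<in> concentrated_on (\<Inter>\<O>)"
    using \<nu> assms(2) by (auto simp: concentrated_on_def)
qed

lemma gdelta_in_concentrated_on:
  assumes "countable \<O>" "\<O> \<noteq> {}" "\<And>V. V \<in> \<O> \<Longrightarrow> open V"
  shows "gdelta_in weak_topology (concentrated_on (\<Inter>\<O>))"
proof -
  have "gdelta_in weak_topology (\<Inter>(concentrated_on ` \<O>))"
    using assms by (intro gdelta_in_Inter) (auto intro: gdelta_in_concentrated_on_open)
  then show ?thesis using concentrated_on_Inter[OF assms] by simp
qed

section \<open>Approximation by measures carried by a countable dense set\<close>

lemma countable_dense_subset:
  fixes S :: "'a::second_countable_topology set"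
  obtains T where "countable T" "T \<subseteq> S" "S \<subseteq> closure T"
proof -
  obtain \<B> :: "'a set set" where \<B>: "countable \<B>" "topological_basis \<B>"
    using ex_countable_basis by blast
  have "\<forall>U\<in>{U \<in> \<B>. U \<inter> S \<noteq> {}}. \<exists>x. x \<in> U \<inter> S" by blast
  from bchoice[OF this] obtain c where c: "\<And>U. U \<in> \<B> \<Longrightarrow> U \<inter> S \<noteq> {} \<Longrightarrow> c U \<in> U \<inter> S"
    by blast
  show thesis
  proof (rule that[of "c ` {U \<in> \<B>. U \<inter> S \<noteq> {}}"])
    show "S \<subseteq> closure (c ` {U \<in> \<B>. U \<inter> S \<noteq> {}})"
    proof
      fix x assume x: "x \<in> S"
      show "x \<in> closure (c ` {U \<in> \<B>. U \<inter> S \<noteq> {}})"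
        unfolding closure_iff_nhds_not_empty
      proof (intro allI impI)
        fix A V assume "V \<subseteq> A" "open V" "x \<in> V"
        then obtain U where "U \<in> \<B>" "x \<in> U" "U \<subseteq> V"
          using topological_basisE[OF \<B>(2)] by blast
        then show "c ` {U \<in> \<B>. U \<inter> S \<noteq> {}} \<inter> A \<noteq> {}"
          using c[of U] x \<open>V \<subseteq> A\<close> by blast
      qed
    qed
  qed (use \<B>(1) c in auto)
qed

text \<open>A measure is approximated by its images under maps that move every matrix by less than
  \<open>1 / (N + 1)\<close> into a fixed countable dense subset of \<open>S\<close>. Countability of the range makes such a
  map measurable without any regularity of the choice.\<close>

lemma dense_concentrated_on:
  assumes S: "S \<in> sets borel" and dense: "distance_matrices \<subseteq> closure (distance_matrices \<inter> S)"
  shows "weak_topology closure_of concentrated_on S = matrix_measures"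
proof -
  obtain T where T: "countable T" "T \<subseteq> distance_matrices \<inter> S"
    "distance_matrices \<inter> S \<subseteq> closure T"
    using countable_dense_subset by blast
  have DT: "distance_matrices \<subseteq> closure T"
    using dense closure_minimal[OF T(3)] by auto
  have "(\<lambda>_ _. 0) \<in> distance_matrices" by (simp add: distance_matrices_def)
  then have "T \<noteq> {}" using DT by auto
  define s where "s = from_nat_into T"
  have s: "s k \<in> distance_matrices" "s k \<in> S" for k
    using from_nat_into[OF \<open>T \<noteq> {}\<close>] T(2) by (auto simp: s_def)
  define \<Phi> where "\<Phi> N r = s (LEAST k. dist (s k) r < inverse (real (Suc N)))" for N r
  have \<Phi>_dist: "dist (\<Phi> N r) r < inverse (real (Suc N))" if "r \<in> distance_matrices" for N r
  proof -
    have "r \<in> closure T" using DT that by blast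
    then obtain y where "y \<in> T" "dist y r < inverse (real (Suc N))"
      unfolding closure_approachable by (metis inverse_positive_iff_positive of_nat_0_less_iff zero_less_Suc)
    moreover obtain k where "s k = y"
      using from_nat_into_surj[OF T(1) \<open>y \<in> T\<close>] by (auto simp: s_def)
    ultimately have "dist (s k) r < inverse (real (Suc N))" by simp
    then show ?thesis unfolding \<Phi>_def by (rule LeastI)
  qed
  have \<Phi>_lim: "(\<lambda>N. \<Phi> N r) \<longlonglongrightarrow> r" if "r \<in> distance_matrices" for r
  proof -
    have "\<forall>\<^sub>F N in sequentially. norm (dist (\<Phi> N r) r) \<le> inverse (real (Suc N))"
      using \<Phi>_dist[OF that] by (intro always_eventually) (auto intro: less_imp_le)
    from Lim_null_comparison[OF this LIMSEQ_inverse_real_of_nat]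
    show ?thesis by (rule iffD2[OF tendsto_dist_iff])
  qed
  have \<Phi>_D: "\<Phi> N r \<in> distance_matrices" "\<Phi> N r \<in> S" for N r
    using s by (auto simp: \<Phi>_def)
  have "\<exists>\<mu>. \<mu> \<in> concentrated_on S \<and> \<mu> \<in> W"
    if \<nu>: "\<nu> \<in> matrix_measures" and W: "openin weak_topology W" "\<nu> \<in> W" for \<nu> W
  proof -
    interpret prob_space \<nu> using matrix_measuresD(1)[OF \<nu>] .
    note space = matrix_measuresD(3)[OF \<nu>]
    have id_meas [measurable]: "(\<lambda>r. r) \<in> measurable \<nu> borel"
      using borel_measurable_continuous_on_restrict[OF continuous_on_id]
        measurable_cong_sets[OF matrix_measuresD(2)[OF \<nu>] refl] by blast
    have \<Phi>_meas: "\<Phi> N \<in> measurable \<nu> \<nu>" for N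
    proof -
      have "(\<lambda>r. LEAST k. dist (s k) r < inverse (real (Suc N))) \<in> measurable \<nu> (count_space UNIV)"
        by measurable
      moreover have "s \<in> measurable (count_space UNIV) \<nu>"
        using s(1) by (simp add: space)
      ultimately show ?thesis unfolding \<Phi>_def by (rule measurable_compose)
    qed
    \<comment> \<open>\<open>\<nu>\<close> also serves as the target, which gives the images the
      sigma-algebra required by \<open>matrix_measures\<close>.\<close>
    define \<mu> where "\<mu> N = distr \<nu> \<nu> (\<Phi> N)" for N
    have \<mu>: "\<mu> N \<in> matrix_measures" for N
      using prob_space_distr[OF \<Phi>_meas] matrix_measuresD(2)[OF \<nu>]
      by (simp add: \<mu>_def matrix_measures_def)
    have "distance_matrices - S \<in> null_sets (\<mu> N)" for N
    proof -
      have "\<Phi> N -` (distance_matrices - S) \<inter> space \<nu> = {}" using \<Phi>_D by blast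
      then show ?thesis
        using sets_matrix_measure(2)[OF \<nu> S] by (simp add: \<mu>_def null_sets_distr_iff[OF \<Phi>_meas])
    qed
    then have conc: "\<mu> N \<in> concentrated_on S" for N
      using \<mu> by (simp add: concentrated_on_def)
    have "(\<lambda>N. \<integral>r. f r \<partial>\<mu> N) \<longlonglongrightarrow> (\<integral>r. f r \<partial>\<nu>)"
      if f: "continuous_on distance_matrices f" "bounded (f ` distance_matrices)"
      for f :: "_ \<Rightarrow> real"
    proof -
      have f_meas: "f \<in> borel_measurable \<nu>"
        using borel_measurable_matrix_measure[OF \<nu> f(1)] .
      obtain B where B: "\<And>r. r \<in> distance_matrices \<Longrightarrow> norm (f r) \<le> B"
        using f(2) by (auto simp: bounded_iff)
      have "(\<lambda>N. \<integral>r. f (\<Phi> N r) \<partial>\<nu>) \<longlonglongrightarrow> (\<integral>r. f r \<partial>\<nu>)"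
      proof (rule integral_dominated_convergence[where w = "\<lambda>_. B"])
        \<comment> \<open>\<open>f\<close> is continuous on the distance matrices only; the
          approximants \<open>\<Phi> N r\<close> remain among them.\<close>
        show "AE r in \<nu>. (\<lambda>N. f (\<Phi> N r)) \<longlonglongrightarrow> f r"
          using continuous_on_tendsto_compose[OF f(1) \<Phi>_lim] \<Phi>_D
          by (intro AE_I2) (simp add: space)
      qed (use B \<Phi>_D f_meas measurable_compose[OF \<Phi>_meas f_meas] in auto)
      then show ?thesis
        by (simp add: \<mu>_def integral_distr[OF \<Phi>_meas f_meas])
    qed
    from eventually_in_weakly_open[OF W \<mu> this]
    have "\<forall>\<^sub>F N in sequentially. \<mu> N \<in> W" .
    then obtain N where "\<mu> N \<in> W"
      using eventually_happens'[OF sequentially_bot] by blast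
    then show ?thesis using conc by blast
  qed
  then show ?thesis
    unfolding closure_of_def by (auto simp: concentrated_on_def)
qed

lemma concentrated_on_generic:
  assumes "countable \<O>" "\<O> \<noteq> {}" "\<And>V. V \<in> \<O> \<Longrightarrow> open V"
    and "\<And>V. V \<in> \<O> \<Longrightarrow> distance_matrices \<subseteq> closure (distance_matrices \<inter> V)"
  shows "gdelta_in weak_topology (concentrated_on (\<Inter>\<O>))"
    and "weak_topology closure_of concentrated_on (\<Inter>\<O>) = matrix_measures"
proof -
  show "gdelta_in weak_topology (concentrated_on (\<Inter>\<O>))"
    using gdelta_in_concentrated_on[OF assms(1-3)] .
  show "weak_topology closure_of concentrated_on (\<Inter>\<O>) = matrix_measures"
  proof (rule dense_concentrated_on)
    show "\<Inter>\<O> \<in> sets borel"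
    proof -
      have "(\<lambda>V. V) ` \<O> \<subseteq> sets borel" using assms(3) by auto
      from sets.countable_INT'[OF assms(1,2) this] show ?thesis by simp
    qed
    show "distance_matrices \<subseteq> closure (distance_matrices \<inter> \<Inter>\<O>)"
      using distance_matrices_Baire[OF assms(1,3,4)] .
  qed
qed

theorem theorem5:
  shows "gdelta_in weak_topology universally_concentrated \<and>
         weak_topology closure_of universally_concentrated = matrix_measures \<and>
         (\<exists>G. gdelta_in weak_topology G \<and> weak_topology closure_of G = matrix_measures \<and>
              (\<forall>\<nu>\<in>G. AE r in \<nu>. r \<in> universal_matrices \<and> Metric_space UNIV r \<and>
                               completion_is_urysohn r)) \<and>
         (\<forall>r\<in>universal_matrices. completion_is_urysohn r)"
proof -
  have univ: "universally_concentrated = concentrated_on (\<Inter>(range extension_set))"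
    by (simp add: universally_concentrated_def concentrated_on_def universal_matrices_eq Diff_Int)
  \<comment> \<open>The second part of the family excludes off-diagonal zeros, so that its
    intersection yields metrics and not merely semimetrics.\<close>
  define \<O> where "\<O> = range extension_set \<union>
    (\<lambda>(i, j). {r :: nat \<Rightarrow> nat \<Rightarrow> real. r i j \<noteq> 0}) ` {(i, j). i \<noteq> j}"
  have "countable \<O>" "\<O> \<noteq> {}" by (auto simp: \<O>_def)
  moreover have "open V" "distance_matrices \<subseteq> closure (distance_matrices \<inter> V)" if "V \<in> \<O>" for V
  proof -
    consider p where "V = extension_set p" | i j where "i \<noteq> j" "V = {r. r i j \<noteq> 0}"
      using \<open>V \<in> \<O>\<close> unfolding \<O>_def by blast
    then have "open V \<and> distance_matrices \<subseteq> closure (distance_matrices \<inter> V)"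
    proof cases
      case 1
      then show ?thesis using open_extension_set dense_extension_set by simp
    next
      case 2
      then show ?thesis
        using dense_entry_nonzero by (simp add: open_Collect_neq continuous_on_entry)
    qed
    then show "open V" "distance_matrices \<subseteq> closure (distance_matrices \<inter> V)" by blast+
  qed
  ultimately have "gdelta_in weak_topology (concentrated_on (\<Inter>\<O>))"
      "weak_topology closure_of concentrated_on (\<Inter>\<O>) = matrix_measures"
    using concentrated_on_generic by blast+
  moreover have "AE r in \<nu>. r \<in> universal_matrices \<and> Metric_space UNIV r \<and> completion_is_urysohn r"
    if "\<nu> \<in> concentrated_on (\<Inter>\<O>)" for \<nu>
  proof -
    have \<nu>: "\<nu> \<in> matrix_measures" "distance_matrices - \<Inter>\<O> \<in> null_sets \<nu>"
      using that by (auto simp: concentrated_on_def)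
    have "r \<in> universal_matrices \<and> Metric_space UNIV r \<and> completion_is_urysohn r"
      if r: "r \<in> distance_matrices" "r \<in> \<Inter>\<O>" for r
    proof -
      have "r \<in> universal_matrices"
        using r by (auto simp: universal_matrices_eq \<O>_def)
      moreover have "Metric_space UNIV r"
      proof
        fix i j k
        show "0 \<le> r i j" "r i j = r j i" "r i k \<le> r i j + r j k"
          using distance_matricesD[OF r(1)] by blast+
        show "r i j = 0 \<longleftrightarrow> i = j"
          using r(2) distance_matricesD(1)[OF r(1)] by (auto simp: \<O>_def)
      qed
      ultimately show ?thesis using universal_completion_is_urysohn by blast
    qed
    then show ?thesis
      by (intro AE_I'[OF \<nu>(2)]) (auto simp: matrix_measuresD(3)[OF \<nu>(1)])
  qed
  moreover have "gdelta_in weak_topology universally_concentrated \<and>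
      weak_topology closure_of universally_concentrated = matrix_measures"
    unfolding univ
  proof (intro conjI)
    have "countable (range extension_set)" "range extension_set \<noteq> {}" by auto
    moreover have "open V" "distance_matrices \<subseteq> closure (distance_matrices \<inter> V)"
      if "V \<in> range extension_set" for V
      using that open_extension_set dense_extension_set by blast+
    ultimately show "gdelta_in weak_topology (concentrated_on (\<Inter>(range extension_set)))"
      "weak_topology closure_of concentrated_on (\<Inter>(range extension_set)) = matrix_measures"
      using concentrated_on_generic by blast+
  qed
  ultimately show ?thesis using universal_completion_is_urysohn by blast
qed

end
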